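(* Let $D$ be a vertebrate directed acyclic graph. The acyclic reorientation lattice $\mathcal{AR}_D$ is (1) distributive if and only if $D$ is a forest; (2) semidistributive if and only if $D$ is filled; (3) always congruence normal; (4) congruence uniform if and only if $D$ is filled.
   Context: All directed graphs are finite and simple. A reorientation of a directed acyclic graph $D=(V,A)$ is a directed graph with the same underlying undirected graph, encoded by the set of arcs of $D$ that it reverses. $\mathcal{AR}_D$ is the poset of acyclic reorientations of $D$ ordered by inclusion of sets of reversed arcs. The transitive reduction of a directed acyclic graph is obtained by deleting all arcs whose endpoints are connected by a directed path of length at least $2$. A directed graph is a forest if its underlying undirected graph has no cycle. $D$ is vertebrate if the transitive reduction of every induced subgraph of $D$ is a forest; $\mathcal{AR}_D$ is a lattice when $D$ is vertebrate. $D$ is filled if for any directed path $\pi$ in $D$, if the arc joining the endpoints of $\pi$ belongs to $D$, then all arcs joining any two vertices of $\pi$ also belong to $D$. A finite lattice $L$ is distributive if $x\vee(y\wedge z)=(x\vee y)\wedge(x\vee z)$ for all $x,y,z$. It is join semidistributive if $x\vee y=x\vee z$ implies $x\vee(y\wedge z)=x\vee y$ for all $x,y,z$; meet semidistributive is the dual notion; semidistributive means both. An element $j$ (resp. $m$) is join (resp. meet) irreducible if it covers (resp. is covered by) a unique element $j_\star$ (resp. $m^\star$). A congruence of $L$ is an equivalence relation compatible with meets and joins; $\mathrm{con}(L)$ is the lattice of congruences ordered by refinement, and $\mathrm{con}(x,y)$ is the minimal congruence with $x\equiv y$. The lattice $L$ is congruence normal if $\mathrm{con}(j_\star,j)\ne\mathrm{con}(m,m^\star)$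 for any join irreducible $j$ and meet irreducible $m$ with $j\le m$ (equivalently, $L$ is constructible from a distributive lattice by doublings of order convex sets). $L$ is congruence uniform if $j\mapsto\mathrm{con}(j_\star,j)$ and $m\mapsto\mathrm{con}(m,m^\star)$ are bijections from the join irreducibles, respectively the meet irreducibles, of $L$ to the join irreducibles of $\mathrm{con}(L)$ (equivalently, $L$ is constructible by doublings of intervals, or equivalently $L$ is congruence normal and semidistributive). *)

theory Defs
  imports "HOL-Algebra.Lattice" "Graph_Theory.Graph_Theory"
begin

section \<open>Directed acyclic graphs and their acyclic reorientations\<close>

text \<open>
  A finite simple directed graph is a pair digraph satisfying \<^locale>\<open>pair_digraph\<close>; it is
  acyclic if its arc relation satisfies \<^const>\<open>acyclic\<close>.
\<close>

text \<open>
  A cycle of the underlying undirected graph is a cycle of its symmetric digraph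
  (\<^const>\<open>mk_symmetric\<close>) of length at least 3; length 2 is an edge traversed back and forth.
  The constant \<^const>\<open>forest\<close> of the graph library is not suitable: it only excludes
  directed cycles.
\<close>

definition forest_digraph :: "'a pair_pre_digraph \<Rightarrow> bool" where
  "forest_digraph D \<longleftrightarrow>
    \<not> (\<exists>p. pre_digraph.cycle (with_proj (mk_symmetric (with_proj D))) p \<and> 3 \<le> length p)"

definition transitive_reduction :: "'a pair_pre_digraph \<Rightarrow> 'a pair_pre_digraph" where
  "transitive_reduction D = \<lparr> pverts = pverts D,
     parcs = parcs D - {(u, v). \<exists>p. vpath p (with_proj D) \<and> hd p = u \<and> last p = v
                                  \<and> 2 \<le> vwalk_length p} \<rparr>"

definition vertebrate :: "'a pair_pre_digraph \<Rightarrow> bool" where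
  "vertebrate D \<longleftrightarrow>
    (\<forall>H :: 'a pair_pre_digraph. induced_subgraph (with_proj H) (with_proj D) \<longrightarrow>
       forest_digraph (transitive_reduction H))"

text \<open>In an acyclic digraph, an arc joining two vertices of a directed path can only point
  forward along the path.\<close>

definition filled :: "'a pair_pre_digraph \<Rightarrow> bool" where
  "filled D \<longleftrightarrow>
    (\<forall>p. vpath p (with_proj D) \<longrightarrow> (hd p, last p) \<in> parcs D \<longrightarrow>
       (\<forall>i j. i < j \<longrightarrow> j < length p \<longrightarrow> (p ! i, p ! j) \<in> parcs D))"

definition reorient :: "'a pair_pre_digraph \<Rightarrow> 'a rel \<Rightarrow> 'a pair_pre_digraph" where
  "reorient D R = \<lparr> pverts = pverts D, parcs = (parcs D - R) \<union> R\<inverse> \<rparr>"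

definition acyclic_reorientations :: "'a pair_pre_digraph \<Rightarrow> 'a rel gorder" where
  "acyclic_reorientations D =
    \<lparr> carrier = {R. R \<subseteq> parcs D \<and> acyclic (parcs (reorient D R))}, eq = (=), le = (\<subseteq>) \<rparr>"

text \<open>Every acyclic digraph with the same underlying undirected graph is encoded this way.\<close>

lemma acyclic_same_underlying_iff_reorient:
  assumes "pair_digraph D" "acyclic (parcs D)" "acyclic (parcs E)"
  shows "mk_symmetric (with_proj E) = mk_symmetric (with_proj D) \<longleftrightarrow>
           (\<exists>R \<subseteq> parcs D. E = reorient D R)"
proof -
  have asym: "(v, u) \<notin> r" if "acyclic r" "(u, v) \<in> r" for r :: "'a rel" and u v
    using that by (meson acyclic_def trancl.simps)
  have eq: "mk_symmetric (with_proj E) = mk_symmetric (with_proj D) \<longleftrightarrow>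
      pverts E = pverts D \<and> parcs E \<union> (parcs E)\<inverse> = parcs D \<union> (parcs D)\<inverse>"
  proof -
    have "(\<Union>e\<in>parcs G. {(fst e, snd e), (snd e, fst e)}) = parcs G \<union> (parcs G)\<inverse>"
      for G :: "'a pair_pre_digraph" by force
    then show ?thesis by (simp add: mk_symmetric_def)
  qed
  show ?thesis
  proof
    assume "mk_symmetric (with_proj E) = mk_symmetric (with_proj D)"
    then have v: "pverts E = pverts D"
      and a: "parcs E \<union> (parcs E)\<inverse> = parcs D \<union> (parcs D)\<inverse>" by (auto simp: eq)
    let ?R = "parcs D \<inter> (parcs E)\<inverse>"
    have "(x, y) \<in> parcs E \<longleftrightarrow> (x, y) \<in> parcs D - ?R \<union> ?R\<inverse>" for x y
      using a asym[OF assms(2), of x y] asym[OF assms(2), of y x]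
        asym[OF assms(3), of x y] asym[OF assms(3), of y x]
      by (auto simp: set_eq_iff)
    then have "parcs E = parcs D - ?R \<union> ?R\<inverse>" by auto
    then have "E = reorient D ?R" using v by (simp add: reorient_def)
    then show "\<exists>R \<subseteq> parcs D. E = reorient D R" by blast
  next
    assume "\<exists>R \<subseteq> parcs D. E = reorient D R"
    then show "mk_symmetric (with_proj E) = mk_symmetric (with_proj D)"
      unfolding eq by (auto simp: reorient_def)
  qed
qed


section \<open>Finite lattices and their congruences\<close>

locale finite_lattice = lattice +
  assumes finite_carrier: "finite (carrier L)"

locale distributive_lattice = finite_lattice +
  assumes join_distrib:
    "\<lbrakk>x \<in> carrier L; y \<in> carrier L; z \<in> carrier L\<rbrakk> \<Longrightarrow>
       x \<squnion> (y \<sqinter> z) = (x \<squnion> y) \<sqinter> (x \<squnion> z)"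

locale join_semidistributive_lattice = finite_lattice +
  assumes join_semidistrib:
    "\<lbrakk>x \<in> carrier L; y \<in> carrier L; z \<in> carrier L; x \<squnion> y = x \<squnion> z\<rbrakk> \<Longrightarrow>
       x \<squnion> (y \<sqinter> z) = x \<squnion> y"

locale meet_semidistributive_lattice = finite_lattice +
  assumes meet_semidistrib:
    "\<lbrakk>x \<in> carrier L; y \<in> carrier L; z \<in> carrier L; x \<sqinter> y = x \<sqinter> z\<rbrakk> \<Longrightarrow>
       x \<sqinter> (y \<squnion> z) = x \<sqinter> y"

locale semidistributive_lattice =
  join_semidistributive_lattice + meet_semidistributive_lattice

definition covers :: "('a, 'b) gorder_scheme \<Rightarrow> 'a \<Rightarrow> 'a \<Rightarrow> bool" where
  "covers L y x \<longleftrightarrow> x \<in> carrier L \<and> y \<in> carrier L \<and> x \<sqsubset>\<^bsub>L\<^esub> y \<and>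
     \<not> (\<exists>z \<in> carrier L. x \<sqsubset>\<^bsub>L\<^esub> z \<and> z \<sqsubset>\<^bsub>L\<^esub> y)"

definition join_irreducibles :: "('a, 'b) gorder_scheme \<Rightarrow> 'a set" where
  "join_irreducibles L = {j \<in> carrier L. \<exists>!i. covers L j i}"

definition meet_irreducibles :: "('a, 'b) gorder_scheme \<Rightarrow> 'a set" where
  "meet_irreducibles L = {m \<in> carrier L. \<exists>!n. covers L n m}"

definition lower_cover :: "('a, 'b) gorder_scheme \<Rightarrow> 'a \<Rightarrow> 'a" where
  "lower_cover L j = (THE i. covers L j i)"

definition upper_cover :: "('a, 'b) gorder_scheme \<Rightarrow> 'a \<Rightarrow> 'a" where
  "upper_cover L m = (THE n. covers L n m)"

definition lattice_congruence :: "('a, 'b) gorder_scheme \<Rightarrow> 'a rel \<Rightarrow> bool" where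
  "lattice_congruence L \<theta> \<longleftrightarrow> equiv (carrier L) \<theta> \<and>
     (\<forall>x x' y y'. (x, x') \<in> \<theta> \<longrightarrow> (y, y') \<in> \<theta> \<longrightarrow>
        (x \<squnion>\<^bsub>L\<^esub> y, x' \<squnion>\<^bsub>L\<^esub> y') \<in> \<theta> \<and> (x \<sqinter>\<^bsub>L\<^esub> y, x' \<sqinter>\<^bsub>L\<^esub> y') \<in> \<theta>)"

definition congruence_lattice :: "('a, 'b) gorder_scheme \<Rightarrow> 'a rel gorder" where
  "congruence_lattice L = \<lparr> carrier = {\<theta>. lattice_congruence L \<theta>}, eq = (=), le = (\<subseteq>) \<rparr>"

definition principal_congruence :: "('a, 'b) gorder_scheme \<Rightarrow> 'a \<Rightarrow> 'a \<Rightarrow> 'a rel" where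
  "principal_congruence L x y =
     (THE \<theta>. least (congruence_lattice L) \<theta> {\<theta>. lattice_congruence L \<theta> \<and> (x, y) \<in> \<theta>})"

lemma (in lattice) least_principal_congruence:
  assumes "x \<in> carrier L" "y \<in> carrier L"
  shows "least (congruence_lattice L) (principal_congruence L x y)
           {\<theta>. lattice_congruence L \<theta> \<and> (x, y) \<in> \<theta>}"
proof -
  let ?C = "{\<theta>. lattice_congruence L \<theta> \<and> (x, y) \<in> \<theta>}"
  have "carrier L \<times> carrier L \<in> ?C"
    using assms by (auto simp: lattice_congruence_def equiv_def refl_on_def sym_def trans_def)
  moreover have "equiv (carrier L) \<theta>" if "\<theta> \<in> ?C" for \<theta>
    using that by (simp add: lattice_congruence_def)
  ultimately have "equiv (carrier L) (\<Inter>?C)"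
    unfolding equiv_def refl_on_def sym_def trans_def by blast
  then have "lattice_congruence L (\<Inter>?C)"
    unfolding lattice_congruence_def by blast
  then have l: "least (congruence_lattice L) (\<Inter>?C) ?C"
    by (auto simp: least_def congruence_lattice_def)
  moreover have "\<theta> = \<Inter>?C" if "least (congruence_lattice L) \<theta> ?C" for \<theta>
    using l that by (auto simp: least_def congruence_lattice_def)
  ultimately show ?thesis
    unfolding principal_congruence_def by (rule theI)
qed

locale congruence_normal_lattice = finite_lattice +
  assumes congruence_normal:
    "\<lbrakk>j \<in> join_irreducibles L; m \<in> meet_irreducibles L; j \<sqsubseteq> m\<rbrakk> \<Longrightarrow>
       principal_congruence L (lower_cover L j) j \<noteq> principal_congruence L m (upper_cover L m)"

locale congruence_uniform_lattice = finite_lattice +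
  assumes join_irreducibles_bij:
    "bij_betw (\<lambda>j. principal_congruence L (lower_cover L j) j)
       (join_irreducibles L) (join_irreducibles (congruence_lattice L))"
  and meet_irreducibles_bij:
    "bij_betw (\<lambda>m. principal_congruence L m (upper_cover L m))
       (meet_irreducibles L) (join_irreducibles (congruence_lattice L))"

end

theory Submission
  imports Defs
begin

text \<open>
  Let A be the arc set of a vertebrate acyclic digraph. A set R of arcs is an acyclic reorientation
  iff no pair of vertices is connected both by a path in R and by a path in A - R: a shortest
  directed cycle of the reorientation is an induced cycle, and the forest condition forces it
  to consist of a directed path of the original digraph and an arc joining the endpoints of that path.
  The join of R and S consists of the arcs in the transitive closure of their union, and
  complementation is an anti-automorphism. A cover relation reverses a single arc.

  An arc (u,v) with a vertex w strictly between u and v yields a failure of distributivity,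
  and, unless (u,w) and (w,v) are both arcs, a failure of semidistributivity and two join
  irreducibles with the same congruence. Restriction to intervals is a lattice homomorphism,
  so the congruence of a cover relation determines the arc it reverses; this gives congruence
  normality. If D is filled, then intervals spanned by arcs are transitive tournaments, a join
  irreducible is determined by its arc (u,v) and the inner vertices w for which (u,w) is
  reversed, and the subropes of a rope induce a congruence that separates it from all others.
\<close>

section \<open>Relations and bridges\<close>

text \<open>The hypothesis on D speaks of undirected cycles, the lattice of directed paths. The link
  is the notion of a bridge: in the transitive reduction of an induced subgraph every arc is one.
  This makes each interval of the reachability order a chain, so that cutting an interval at a
  vertex behaves as in a total order and inductions can run over the size of an interval. The
  characterization of acyclic reorientations is invariant under \<open>R\<close> to
  \<open>A - R\<close>; hence statements on meets and meet irreducibles follow from those on joins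
  and join irreducibles. In every finite lattice the maps from irreducibles to join irreducible
  congruences are onto, so congruence uniformity is a matter of injectivity. Complementation gives
  as many meet as join irreducibles, which leaves injectivity on join irreducibles. The separating
  congruence is the kernel of the map sending \<open>Q\<close> to the subropes that it contains; the
  hard point is that the subropes of a join are determined by those of the two joinands.\<close>

lemma rtrancl_avoid_arc:
  assumes "(a, b) \<in> r\<^sup>*" "(a, x) \<notin> r\<^sup>* \<or> (y, b) \<notin> r\<^sup>*"
  shows "(a, b) \<in> (r - {(x, y)})\<^sup>*"
  using assms
proof (induction rule: converse_rtrancl_induct)
  case (step a c)
  have "(a, c) \<noteq> (x, y)" using step by auto
  moreover have "(c, x) \<notin> r\<^sup>* \<or> (y, b) \<notin> r\<^sup>*"
    using step by (meson converse_rtrancl_into_rtrancl)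
  ultimately show ?case using step by (meson DiffI converse_rtrancl_into_rtrancl singletonD)
qed simp

text \<open>Stop at the first visit to \<open>p\<close>: no arc leaving \<open>p\<close> has been
  used by then.\<close>

lemma rtrancl_avoid_arc_to_source:
  assumes "(a, p) \<in> r\<^sup>*"
  shows "(a, p) \<in> (r - {(p, q)})\<^sup>*"
  using assms
proof (induction rule: converse_rtrancl_induct)
  case (step a c)
  then show ?case
    by (cases "a = p") (auto intro: converse_rtrancl_into_rtrancl)
qed simp

text \<open>The forest condition in terms of reachability: each arc is a bridge of the underlying
  undirected graph. Loops and antiparallel arcs are excluded as well.\<close>

definition bridged :: "'a rel \<Rightarrow> bool" where
  "bridged T \<longleftrightarrow> (\<forall>(u, v) \<in> T. (v, u) \<notin> (T - {(u, v)} \<union> (T - {(u, v)})\<inverse>)\<^sup>*)"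

lemma forest_digraph_bridged:
  assumes F: "forest_digraph T" and wf: "parcs T \<subseteq> pverts T \<times> pverts T" and ac: "acyclic (parcs T)"
  shows "bridged (parcs T)"
  unfolding bridged_def
proof (clarify)
  fix u v
  let ?r = "parcs T - {(u, v)} \<union> (parcs T - {(u, v)})\<inverse>"
  let ?G = "\<lparr> pverts = pverts T, parcs = ?r \<rparr>"
  let ?S = "mk_symmetric (with_proj T)"
  assume uv: "(u, v) \<in> parcs T" and path: "(v, u) \<in> ?r\<^sup>*"
  interpret G: pair_wf_digraph ?G
    using wf by unfold_locales auto
  have ne: "u \<noteq> v" and vu: "(v, u) \<notin> parcs T"
    using ac uv by (auto simp: acyclic_def) (meson r_into_trancl trancl_into_trancl)
  have "v \<in> pverts T" using wf uv by auto
  have "(v, z) \<in> rtrancl_on (pverts ?G) ?r" if "(v, z) \<in> ?r\<^sup>*" for z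
    using that
  proof (induction rule: rtrancl_induct)
    case base
    then show ?case using \<open>v \<in> pverts T\<close> by simp
  next
    case (step y z)
    then show ?case using wf by (intro rtrancl_on_into_rtrancl_on[OF step(3)]) auto
  qed
  then have "v \<rightarrow>\<^sup>*\<^bsub>with_proj ?G\<^esub> u" using path by (simp add: reachable_def)
  then obtain p where p: "G.apath v p u" using G.reachable_apath by blast
  then have aw: "G.awalk v p u" and d: "distinct (pawalk_verts v p)"
    by (auto simp: G.apath_def)
  then have cas: "pcas v p u" and sub: "set p \<subseteq> ?r"
    by (auto simp: G.awalk_def)
  have sub': "set p \<subseteq> parcs ?S"
    using sub by (force simp: parcs_mk_symmetric)
  \<comment> \<open>The empty path is excluded by \<open>u \<noteq> v\<close>, and a single arc
    because \<open>(v, u)\<close> is not an arc of \<open>T\<close> and \<open>(u, v)\<close> has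
    been removed. So closing \<open>p\<close> by \<open>(u, v)\<close> gives length at least
    3.\<close>
  have "2 \<le> length p"
  proof (rule ccontr)
    assume "\<not> 2 \<le> length p"
    then have "p = [] \<or> (\<exists>e. p = [e])" by (cases p; cases "tl p") auto
    then show False using cas ne sub vu by auto
  qed
  then have "pre_digraph.cycle (with_proj ?S) ((u, v) # p) \<and> 3 \<le> length ((u, v) # p)"
    using cas sub' d uv wf
    by (force simp: pre_digraph.cycle_def pre_digraph.awalk_def parcs_mk_symmetric)
  then show False using F unfolding forest_digraph_def by blast
qed

text \<open>A closed walk of minimal length has no chord: the only arcs inside its vertex set
  \<open>W\<close> are its own, hence successors and predecessors are unique.\<close>

lemma shortest_cycle:
  assumes "\<not> acyclic E"
  obtains W p q where "(p, q) \<in> Restr E W" "(q, p) \<in> (Restr E W)\<^sup>*"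
    "\<And>u v x. \<lbrakk>(u, v) \<in> Restr E W; (u, x) \<in> Restr E W\<rbrakk> \<Longrightarrow> v = x"
    "\<And>u v x. \<lbrakk>(v, u) \<in> Restr E W; (x, u) \<in> Restr E W\<rbrakk> \<Longrightarrow> v = x"
proof -
  let ?P = "\<lambda>n. 0 < n \<and> (\<exists>x. (x, x) \<in> E ^^ n)"
  define n where "n = (LEAST n. ?P n)"
  have "\<exists>n. ?P n"
    using assms by (auto simp: acyclic_def trancl_power)
  then have n: "0 < n" "\<exists>x. (x, x) \<in> E ^^ n"
    unfolding n_def using LeastI_ex[of ?P] by blast+
  have min: "n \<le> m" if "0 < m" "(y, y) \<in> E ^^ m" for m y
    unfolding n_def using that by (intro Least_le) blast
  obtain x where "(x, x) \<in> E ^^ n" using n(2) by blast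
  then obtain f where f: "f n = f 0" "\<And>i. i < n \<Longrightarrow> (f i, f (Suc i)) \<in> E"
    unfolding relpow_fun_conv by blast
  define W where "W = f ` {..<n}"
  have fW: "f i \<in> W" if "i \<le> n" for i
    using that n(1) f(1) by (cases "i = n") (auto simp: W_def)
  have seg: "(f i, f (i + k)) \<in> (Restr E W) ^^ k" if "i + k \<le> n" for i k
    using that
  proof (induction k)
    case (Suc k)
    then have "(f (i + k), f (i + Suc k)) \<in> Restr E W" using f(2)[of "i + k"] fW by auto
    then show ?case using Suc by (auto intro: relcompI)
  qed simp
  have segE: "(f i, f (i + k)) \<in> E ^^ k" if "i + k \<le> n" for i k
    using that f(2) by (induction k) (auto intro: relcompI)
  \<comment> \<open>If \<open>j \<le> i\<close>, the arc closes a walk of length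
    \<open>i - j + 1\<close>; if \<open>i < j\<close>, going round through \<open>f 0\<close> closes
    one of length \<open>n - j + i + 1\<close>. Minimality of \<open>n\<close> leaves only the next
    vertex of the cycle.\<close>
  have succ: "j = (if Suc i = n then 0 else Suc i)" if "i < n" "j < n" "(f i, f j) \<in> E" for i j
  proof (cases "j \<le> i")
    case True
    then have "(f j, f i) \<in> E ^^ (i - j)" using segE[of j "i - j"] that by auto
    then have "(f j, f j) \<in> E ^^ Suc (i - j)" using that by auto
    then have "n \<le> Suc (i - j)" using min by blast
    then show ?thesis using that True by auto
  next
    case False
    have "(f j, f 0) \<in> E ^^ (n - j)" using segE[of j "n - j"] that f(1) by auto
    moreover have "(f 0, f i) \<in> E ^^ i" using segE[of 0 i] that by auto
    ultimately have "(f j, f i) \<in> E ^^ (n - j + i)" by (auto simp: relpow_add)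
    then have "(f j, f j) \<in> E ^^ Suc (n - j + i)" using that by auto
    then have "n \<le> Suc (n - j + i)" using min by blast
    then show ?thesis using that False by auto
  qed
  show thesis
  proof
    show "(f 0, f 1) \<in> Restr E W" using seg[of 0 1] n by auto
    show "(f 1, f 0) \<in> (Restr E W)\<^sup>*"
      using seg[of 1 "n - 1"] n(1) f(1) by (auto intro: relpow_imp_rtrancl)
    fix u v x
    show "v = x" if "(u, v) \<in> Restr E W" "(u, x) \<in> Restr E W"
      using that succ by (auto simp: W_def)
    show "v = x" if vx: "(v, u) \<in> Restr E W" "(x, u) \<in> Restr E W"
    proof -
      obtain i j k where "v = f i" "x = f j" "u = f k" "i < n" "j < n" "k < n"
        using vx unfolding W_def by blast
      then have "k = (if Suc i = n then 0 else Suc i)" "k = (if Suc j = n then 0 else Suc j)"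
        using that succ by blast+
      then have "i = j" by (metis Zero_not_Suc nat.inject)
      then show ?thesis using \<open>v = f i\<close> \<open>x = f j\<close> by simp
    qed
  qed
qed

lemma bridged_both:
  assumes "bridged T" "(u, v) \<in> T"
  shows "(v, u) \<notin> (T - {(u, v)} \<union> (T - {(u, v)})\<inverse>)\<^sup>*"
    "(u, v) \<notin> (T - {(u, v)} \<union> (T - {(u, v)})\<inverse>)\<^sup>*"
proof -
  let ?r = "T - {(u, v)} \<union> (T - {(u, v)})\<inverse>"
  show "(v, u) \<notin> ?r\<^sup>*" using assms by (auto simp: bridged_def)
  moreover have "sym (?r\<^sup>*)" by (intro sym_rtrancl) (auto simp: sym_def)
  ultimately show "(u, v) \<notin> ?r\<^sup>*" by (meson symD)
qed

text \<open>A directed cycle without one of its arcs is an undirected path joining the endpoints of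
  that arc, which is then not a bridge.\<close>

lemma bridged_reorient_acyclic:
  assumes T: "bridged T" and R: "R \<subseteq> T"
  shows "acyclic (T - R \<union> R\<inverse>)"
proof (rule ccontr)
  let ?E = "T - R \<union> R\<inverse>"
  assume "\<not> acyclic ?E"
  then obtain p q where pq: "(p, q) \<in> ?E" "(q, p) \<in> ?E\<^sup>*"
    unfolding acyclic_def by (meson tranclD)
  then have qp: "(q, p) \<in> (?E - {(p, q)})\<^sup>*" by (intro rtrancl_avoid_arc_to_source)
  from pq(1) show False
  proof
    assume a: "(p, q) \<in> T - R"
    have "(?E - {(p, q)})\<^sup>* \<subseteq> (T - {(p, q)} \<union> (T - {(p, q)})\<inverse>)\<^sup>*"
      by (rule rtrancl_mono) (use a R in auto)
    then show False using bridged_both(1)[OF T, of p q] a qp by blast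
  next
    assume "(p, q) \<in> R\<inverse>"
    then have a: "(q, p) \<in> R" by simp
    have "(?E - {(p, q)})\<^sup>* \<subseteq> (T - {(q, p)} \<union> (T - {(q, p)})\<inverse>)\<^sup>*"
      by (rule rtrancl_mono) (use a R in auto)
    then show False using bridged_both(2)[OF T, of q p] a R qp by blast
  qed
qed

lemma rtrancl_leaves:
  assumes "(a, b) \<in> r\<^sup>*" "(a, b) \<notin> F\<^sup>*"
  shows "\<exists>x y. (x, y) \<in> r - F \<and> (a, x) \<in> r\<^sup>* \<and> (y, b) \<in> r\<^sup>*"
  using assms
proof (induction rule: converse_rtrancl_induct)
  case (step a c)
  show ?case
  proof (cases "(a, c) \<in> F")
    case True
    then have "(c, b) \<notin> F\<^sup>*" using step(4) by (meson converse_rtrancl_into_rtrancl)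
    then obtain x y where "(x, y) \<in> r - F" "(c, x) \<in> r\<^sup>*" "(y, b) \<in> r\<^sup>*" using step by blast
    then show ?thesis using step(1) by (meson converse_rtrancl_into_rtrancl)
  next
    case False
    then show ?thesis using step by blast
  qed
qed simp

lemma rtrancl_exits:
  assumes "(a, b) \<in> r\<^sup>*" "a \<in> P" "b \<notin> P"
  shows "\<exists>x y. (x, y) \<in> r \<and> x \<in> P \<and> y \<notin> P \<and> (a, x) \<in> r\<^sup>* \<and> (y, b) \<in> r\<^sup>*"
  using assms
proof (induction rule: converse_rtrancl_induct)
  case (step a c)
  show ?case
  proof (cases "c \<in> P")
    case True
    then obtain x y where "(x, y) \<in> r" "x \<in> P" "y \<notin> P" "(c, x) \<in> r\<^sup>*" "(y, b) \<in> r\<^sup>*"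
      using step by blast
    then show ?thesis using step(1) by (meson converse_rtrancl_into_rtrancl)
  next
    case False
    then show ?thesis using step by blast
  qed
qed simp

section \<open>Vertebrate acyclic digraphs\<close>

locale vertebrate_dag =
  fixes D :: "'a pair_pre_digraph"
  assumes digraph: "pair_digraph D" and acyclic_arcs: "acyclic (parcs D)"
    and vertebrate: "vertebrate D"
begin

abbreviation A where "A \<equiv> parcs D"

lemma arcs_verts: "A \<subseteq> pverts D \<times> pverts D"
proof -
  interpret pair_digraph D by (rule digraph)
  show ?thesis using in_arcsD1 in_arcsD2 by auto
qed

lemma finite_arcs: "finite A"
proof -
  interpret pair_digraph D by (rule digraph)
  show ?thesis by simp
qed

lemma finite_verts: "finite (pverts D)"
proof -
  interpret pair_digraph D by (rule digraph)
  show ?thesis by simp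
qed

lemma less_irrefl: "(u, u) \<notin> A\<^sup>+"
  using acyclic_arcs by (simp add: acyclic_def)

lemma less_not_le: "(u, v) \<in> A\<^sup>+ \<Longrightarrow> (v, u) \<notin> A\<^sup>*"
  by (meson less_irrefl trancl_rtrancl_trancl)

lemma le_antisym: "(u, v) \<in> A\<^sup>* \<Longrightarrow> (v, u) \<in> A\<^sup>* \<Longrightarrow> u = v"
  by (meson less_not_le rtranclD)

text \<open>Passage from list paths to relations; the second vertex of the path serves as
  \<open>x\<close>.\<close>

lemma vpath_inner:
  assumes p: "vpath p (with_proj H)" "hd p = u" "last p = v" "2 \<le> vwalk_length p"
  obtains x where "(u, x) \<in> parcs H" "(x, v) \<in> (parcs H)\<^sup>+"
proof -
  obtain x p' where px: "p = u # x # p'" and p': "p' \<noteq> []"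
    using p by (cases p; cases "tl p"; cases "tl (tl p)") auto
  have "(x, last (x # p')) \<in> (parcs H)\<^sup>*" if "set (vwalk_arcs (x # p')) \<subseteq> parcs H" for x p'
    using that
  proof (induction p' arbitrary: x)
    case (Cons y p')
    then have "(x, y) \<in> parcs H" "(y, last (y # p')) \<in> (parcs H)\<^sup>*" by auto
    then show ?case by (simp add: converse_rtrancl_into_rtrancl)
  qed simp
  then have "(x, v) \<in> (parcs H)\<^sup>*"
    using p px by (auto simp: vpath_def vwalk_def)
  moreover have "x \<noteq> v"
    using p px p' by (auto simp: vpath_def)
  moreover have "(u, x) \<in> parcs H" using p px by (auto simp: vpath_def vwalk_def)
  ultimately show thesis using that by (meson rtranclD)
qed

text \<open>The vertebrate hypothesis in relational form: \<open>T\<close> is the arc set of the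
  transitive reduction of the subgraph induced on \<open>W\<close>, and an arc missing from it is
  bypassed inside \<open>W\<close>.\<close>

lemma bridged_reduction:
  "\<exists>T \<subseteq> Restr A W. bridged T \<and>
    (\<forall>(u, v) \<in> Restr A W - T. \<exists>x. (u, x) \<in> Restr A W \<and> (x, v) \<in> (Restr A W)\<^sup>+)"
proof -
  define H where "H = \<lparr> pverts = W \<inter> pverts D, parcs = Restr A W \<rparr>"
  interpret D: pair_digraph D by (rule digraph)
  have "wf_digraph (with_proj H)"
    using arcs_verts by unfold_locales (auto simp: H_def)
  then have "induced_subgraph (with_proj H) (with_proj D)"
    using D.wf_digraph_axioms arcs_verts
    by (auto simp: induced_subgraph_def subgraph_def H_def compatible_def)
  then have F: "forest_digraph (transitive_reduction H)"
    using vertebrate by (simp add: vertebrate_def)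
  let ?T = "parcs (transitive_reduction H)"
  have T: "?T \<subseteq> Restr A W" by (auto simp: transitive_reduction_def H_def)
  have "bridged ?T"
  proof (rule forest_digraph_bridged[OF F])
    show "acyclic ?T" using acyclic_arcs by (rule acyclic_subset) (use T in auto)
    show "?T \<subseteq> pverts (transitive_reduction H) \<times> pverts (transitive_reduction H)"
      using arcs_verts by (auto simp: transitive_reduction_def H_def)
  qed
  moreover have "\<exists>x. (u, x) \<in> Restr A W \<and> (x, v) \<in> (Restr A W)\<^sup>+"
    if "(u, v) \<in> Restr A W - ?T" for u v
  proof -
    have H: "parcs H = Restr A W" by (simp add: H_def)
    then have "\<exists>p. vpath p (with_proj H) \<and> hd p = u \<and> last p = v \<and> 2 \<le> vwalk_length p"
      using that unfolding transitive_reduction_def by auto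
    then show ?thesis using vpath_inner[of _ H u v] H by metis
  qed
  ultimately show ?thesis using T by blast
qed

definition between :: "'a \<Rightarrow> 'a \<Rightarrow> 'a set" where
  "between u v = {z. (u, z) \<in> A\<^sup>* \<and> (z, v) \<in> A\<^sup>*}"

lemma finite_between: "finite (between u v)"
proof -
  have "between u v \<subseteq> insert u (pverts D)"
    using arcs_verts by (auto simp: between_def elim: rtranclE)
  then show ?thesis using finite_verts finite_subset by blast
qed

text \<open>With its mirror image below, this makes the size of an interval an induction measure for
  splitting paths.\<close>

lemma between_psubset1:
  assumes "(u, w) \<in> A\<^sup>+" "(w, v) \<in> A\<^sup>*"
  shows "between w v \<subset> between u v"
proof
  show "between w v \<subseteq> between u v"
    using assms by (auto simp: between_def intro: trancl_into_rtrancl rtrancl_trans)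
  have "u \<in> between u v" "u \<notin> between w v"
    using assms less_not_le by (auto simp: between_def dest: trancl_into_rtrancl intro: rtrancl_trans)
  then show "between w v \<noteq> between u v" by blast
qed

lemma between_psubset2:
  assumes "(u, w) \<in> A\<^sup>*" "(w, v) \<in> A\<^sup>+"
  shows "between u w \<subset> between u v"
proof
  show "between u w \<subseteq> between u v"
    using assms by (auto simp: between_def intro: trancl_into_rtrancl rtrancl_trans)
  have "v \<in> between u v" "v \<notin> between u w"
    using assms less_not_le by (auto simp: between_def dest: trancl_into_rtrancl intro: rtrancl_trans)
  then show "between u w \<noteq> between u v" by blast
qed

text \<open>Two incomparable elements of an interval would close a cycle in the transitive reduction.\<close>

lemma interval_chain:
  assumes le: "(u, x) \<in> (Restr A W)\<^sup>*" "(x, v) \<in> (Restr A W)\<^sup>*"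
    "(u, y) \<in> (Restr A W)\<^sup>*" "(y, v) \<in> (Restr A W)\<^sup>*"
  shows "(x, y) \<in> (Restr A W)\<^sup>* \<or> (y, x) \<in> (Restr A W)\<^sup>*"
proof (rule ccontr)
  let ?B = "Restr A W"
  assume "\<not> ?thesis"
  then have inc: "(x, y) \<notin> ?B\<^sup>*" "(y, x) \<notin> ?B\<^sup>*" by auto
  obtain T where T: "T \<subseteq> ?B" "bridged T"
    and red: "\<forall>(u, v) \<in> ?B - T. \<exists>x. (u, x) \<in> ?B \<and> (x, v) \<in> ?B\<^sup>+"
    using bridged_reduction[of W] by blast
  have BA: "(a, b) \<in> A\<^sup>+" if "(a, b) \<in> ?B\<^sup>+" for a b
    using that by (rule trancl_mono) auto
  \<comment> \<open>The reduction keeps reachability: a pair with a vertex strictly between splits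
    into two pairs with smaller intervals, and any other pair is an arc of \<open>T\<close>.\<close>
  have gen: "(a, b) \<in> T\<^sup>+" if "(a, b) \<in> ?B\<^sup>+" for a b
    using that
  proof (induction "card (between a b)" arbitrary: a b rule: less_induct)
    case less
    show ?case
    proof (cases "\<exists>z. (a, z) \<in> ?B\<^sup>+ \<and> (z, b) \<in> ?B\<^sup>+")
      case True
      then obtain z where z: "(a, z) \<in> ?B\<^sup>+" "(z, b) \<in> ?B\<^sup>+" by blast
      have "between a z \<subset> between a b" "between z b \<subset> between a b"
        using BA[OF z(1)] BA[OF z(2)]
        by (auto intro!: between_psubset1 between_psubset2 intro: trancl_into_rtrancl)
      then have "(a, z) \<in> T\<^sup>+" "(z, b) \<in> T\<^sup>+"
        using less z psubset_card_mono[OF finite_between] by blast+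
      then show ?thesis by (rule trancl_trans)
    next
      case False
      have "(a, b) \<in> ?B"
        using less(2) False by (meson tranclE r_into_trancl)
      then have "(a, b) \<in> T" using red False by blast
      then show ?thesis by blast
    qed
  qed
  have le': "(a, b) \<in> T\<^sup>*" if "(a, b) \<in> ?B\<^sup>*" for a b
    using that gen by (metis rtranclD rtrancl_eq_or_trancl)
  have leB: "(a, b) \<in> ?B\<^sup>*" if "(a, b) \<in> T\<^sup>*" for a b
    using that T(1) rtrancl_mono by blast
  have "(x, v) \<in> ?B\<^sup>+" using le(2,4) inc by (metis rtranclD)
  \<comment> \<open>The cycle: \<open>(x, x')\<close> is the first arc of a path in \<open>T\<close>
    from \<open>x\<close> to \<open>v\<close>. Paths in \<open>T\<close> from \<open>u\<close> to
    \<open>x\<close>, \<open>u\<close> to \<open>y\<close>, \<open>y\<close> to \<open>v\<close> and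
    \<open>x'\<close> to \<open>v\<close> avoid this arc, so together they still connect
    \<open>x'\<close> to \<open>x\<close> and it is not a bridge.\<close>
  then obtain x' where x': "(x, x') \<in> T" "(x', v) \<in> T\<^sup>*"
    using gen by (meson tranclD)
  have nx: "(x', x) \<notin> T\<^sup>*"
  proof
    assume "(x', x) \<in> T\<^sup>*"
    then have "(x, x) \<in> T\<^sup>+" using x' by (meson rtrancl_into_trancl2)
    then show False using less_irrefl BA T(1) trancl_mono by blast
  qed
  let ?e = "T - {(x, x')}"
  have "(u, x) \<in> ?e\<^sup>*" by (rule rtrancl_avoid_arc) (use le' le nx in auto)
  moreover have "(u, y) \<in> ?e\<^sup>*"
  proof (rule rtrancl_avoid_arc)
    show "(u, x) \<notin> T\<^sup>* \<or> (x', y) \<notin> T\<^sup>*"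
      using inc leB x' by (meson converse_rtrancl_into_rtrancl)
  qed (use le' le in auto)
  moreover have "(y, v) \<in> ?e\<^sup>*" by (rule rtrancl_avoid_arc) (use le' le inc leB in auto)
  moreover have "(x', v) \<in> ?e\<^sup>*" by (rule rtrancl_avoid_arc) (use x' nx in auto)
  moreover have "?e\<^sup>* \<subseteq> (?e \<union> ?e\<inverse>)\<^sup>*" by (rule rtrancl_mono) blast
  moreover have "(?e\<inverse>)\<^sup>* \<subseteq> (?e \<union> ?e\<inverse>)\<^sup>*" by (rule rtrancl_mono) blast
  ultimately have "(x', v) \<in> (?e \<union> ?e\<inverse>)\<^sup>*" "(v, y) \<in> (?e \<union> ?e\<inverse>)\<^sup>*"
    "(y, u) \<in> (?e \<union> ?e\<inverse>)\<^sup>*" "(u, x) \<in> (?e \<union> ?e\<inverse>)\<^sup>*"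
    by (auto simp: rtrancl_converse)
  then have "(x', x) \<in> (?e \<union> ?e\<inverse>)\<^sup>*" by (meson rtrancl_trans)
  then show False using T(2) x'(1) by (auto simp: bridged_def)
qed

end

section \<open>The lattice of acyclic reorientations\<close>

context vertebrate_dag
begin

text \<open>The condition ranges over all pairs of vertices, not only over arcs, and is symmetric in
  \<open>R\<close> and \<open>A - R\<close>.\<close>

definition biclosed :: "'a rel \<Rightarrow> bool" where
  "biclosed R \<longleftrightarrow> R \<subseteq> A \<and> R\<^sup>+ \<inter> (A - R)\<^sup>+ = {}"

lemma biclosedI:
  assumes "R \<subseteq> A" "\<And>x y. (x, y) \<in> R\<^sup>+ \<Longrightarrow> (x, y) \<in> (A - R)\<^sup>+ \<Longrightarrow> False"
  shows "biclosed R"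
  using assms by (auto simp: biclosed_def)

lemma biclosedD: "biclosed R \<Longrightarrow> R \<subseteq> A" "biclosed R \<Longrightarrow> (u, v) \<in> R\<^sup>+ \<Longrightarrow> (u, v) \<notin> (A - R)\<^sup>+"
  by (auto simp: biclosed_def)

lemma biclosed_closed: "biclosed R \<Longrightarrow> (u, v) \<in> R\<^sup>+ \<Longrightarrow> (u, v) \<in> A \<Longrightarrow> (u, v) \<in> R"
  using biclosedD(2) by blast

lemma biclosed_compl: "biclosed R \<Longrightarrow> biclosed (A - R)"
  by (auto simp: biclosed_def double_diff)

lemma biclosed_triangle:
  assumes "biclosed R" "(u, w) \<in> A" "(w, v) \<in> A" "(u, v) \<in> R"
  shows "(u, w) \<in> R \<or> (w, v) \<in> R"
proof (rule ccontr)
  assume "\<not> ?thesis"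
  then have "(u, v) \<in> (A - R)\<^sup>+" using assms by (meson DiffI r_into_trancl trancl_into_trancl)
  then show False using assms biclosedD(2) by blast
qed

text \<open>Inside \<open>W\<close> the reorientation leaves \<open>u\<close> only through
  \<open>(u, v)\<close>, so \<open>(u, x)\<close> must be reversed. A vertex entered by a reversed
  arc already has its unique successor behind it, so the next arc of the path is reversed too, and
  so on up to \<open>v\<close>.\<close>

lemma reversed_path:
  assumes R: "R \<subseteq> A"
    and out: "\<And>u v x. \<lbrakk>(u, v) \<in> Restr (A - R \<union> R\<inverse>) W; (u, x) \<in> Restr (A - R \<union> R\<inverse>) W\<rbrakk> \<Longrightarrow> v = x"
    and uv: "(u, v) \<in> Restr A W" "(u, v) \<notin> R"
    and x: "(u, x) \<in> Restr A W" "(x, v) \<in> (Restr A W)\<^sup>+"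
  shows "(u, v) \<in> R\<^sup>+"
proof -
  have ne: "x \<noteq> v"
    using x(2) less_irrefl trancl_mono[of _ "Restr A W" A] by blast
  have "(u, z) \<in> R\<^sup>+ \<and> (\<exists>y \<in> W. (y, z) \<in> R)" if "(x, z) \<in> (Restr A W)\<^sup>*" for z
    using that
  proof (induction rule: rtrancl_induct)
    case base
    have "(u, x) \<in> R" using out[of u v x] uv x ne by auto
    then show ?case using x(1) by auto
  next
    case (step y z)
    then obtain w where w: "w \<in> W" "(w, y) \<in> R" by blast
    have "(y, z) \<in> R"
    proof (rule ccontr)
      assume "(y, z) \<notin> R"
      then have "w = z" using out[of y w z] w step by auto
      then have "(y, y) \<in> A\<^sup>+" using w R step(2) by (auto intro: trancl_into_trancl)
      then show False by (simp add: less_irrefl)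
    qed
    then show ?case using step by (auto intro: trancl_into_trancl)
  qed
  then show ?thesis using x(2) by (meson trancl_into_rtrancl)
qed

lemma biclosed_iff_acyclic:
  assumes R: "R \<subseteq> A"
  shows "biclosed R \<longleftrightarrow> acyclic (A - R \<union> R\<inverse>)"
proof
  let ?E = "A - R \<union> R\<inverse>"
  assume ac: "acyclic ?E"
  have False if "(u, v) \<in> R\<^sup>+" "(u, v) \<in> (A - R)\<^sup>+" for u v
  proof -
    have "(v, u) \<in> (R\<inverse>)\<^sup>+" using that(1) by (simp add: trancl_converse)
    then have "(v, u) \<in> ?E\<^sup>+" by (rule trancl_mono) auto
    moreover have "(u, v) \<in> ?E\<^sup>+" using that(2) by (rule trancl_mono) auto
    ultimately show False using ac by (meson acyclic_def trancl_trans)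
  qed
  then show "biclosed R" using R by (auto simp: biclosed_def)
next
  let ?E = "A - R \<union> R\<inverse>"
  assume biclosed: "biclosed R"
  show "acyclic ?E"
  proof (rule ccontr)
    assume "\<not> acyclic ?E"
    then show False
    proof (rule shortest_cycle)
      fix W p q
      assume pq: "(p, q) \<in> Restr ?E W" "(q, p) \<in> (Restr ?E W)\<^sup>*"
        and out: "\<And>u v x. \<lbrakk>(u, v) \<in> Restr ?E W; (u, x) \<in> Restr ?E W\<rbrakk> \<Longrightarrow> v = x"
        and inn: "\<And>u v x. \<lbrakk>(v, u) \<in> Restr ?E W; (x, u) \<in> Restr ?E W\<rbrakk> \<Longrightarrow> v = x"
      obtain T where T: "T \<subseteq> Restr A W" "bridged T"
        and red: "\<forall>(u, v) \<in> Restr A W - T. \<exists>x. (u, x) \<in> Restr A W \<and> (x, v) \<in> (Restr A W)\<^sup>+"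
        using bridged_reduction[of W] by blast
      \<comment> \<open>Otherwise the cycle would live in a reorientation of a forest.\<close>
      have "T \<noteq> Restr A W"
      proof
        assume eq: "T = Restr A W"
        have "acyclic (T - Restr R W \<union> (Restr R W)\<inverse>)"
          by (rule bridged_reorient_acyclic[OF T(2)]) (use eq R in auto)
        moreover have "T - Restr R W \<union> (Restr R W)\<inverse> = Restr ?E W" using eq by auto
        ultimately show False using pq by (metis acyclic_def rtrancl_into_trancl2)
      qed
      then obtain u v where uv: "(u, v) \<in> Restr A W" "(u, v) \<notin> T" using T(1) by auto
      then obtain x where x: "(u, x) \<in> Restr A W" "(x, v) \<in> (Restr A W)\<^sup>+" using red by blast
      show False
      proof (cases "(u, v) \<in> R")
        case False
        then have "(u, v) \<in> R\<^sup>+" by (intro reversed_path[OF R _ uv(1) False x]) (rule out)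
        then show False using False uv biclosed_closed[OF biclosed] by blast
      next
        case True
        \<comment> \<open>Reversing \<open>A - R\<close> instead of \<open>R\<close> yields the
          opposite digraph, where unique predecessors become unique successors.\<close>
        have dd: "A - (A - R) \<union> (A - R)\<inverse> = ?E\<inverse>" using R by auto
        have "(u, v) \<in> (A - R)\<^sup>+"
          by (rule reversed_path[where W = W, OF _ _ uv(1) _ x])
            (use True inn in \<open>auto simp: dd\<close>)
        then show False using True biclosedD(2)[OF biclosed] by blast
      qed
    qed
  qed
qed

lemma AR_simps:
  "carrier (acyclic_reorientations D) = {R. biclosed R}"
  "le (acyclic_reorientations D) = (\<subseteq>)"
  "eq (acyclic_reorientations D) = (=)"
proof -
  have "R \<subseteq> A \<and> acyclic (A - R \<union> R\<inverse>) \<longleftrightarrow> biclosed R" for R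
    using biclosed_iff_acyclic biclosedD(1) by blast
  then show "carrier (acyclic_reorientations D) = {R. biclosed R}"
    by (simp add: acyclic_reorientations_def reorient_def)
qed (simp_all add: acyclic_reorientations_def)

section \<open>Joins and meets of biclosed sets\<close>

definition rel_join :: "'a rel \<Rightarrow> 'a rel \<Rightarrow> 'a rel" where
  "rel_join R S = (R \<union> S)\<^sup>+ \<inter> A"

definition rel_meet :: "'a rel \<Rightarrow> 'a rel \<Rightarrow> 'a rel" where
  "rel_meet R S = A - rel_join (A - R) (A - S)"

lemma trancl_rel_join: "R \<subseteq> A \<Longrightarrow> S \<subseteq> A \<Longrightarrow> (rel_join R S)\<^sup>+ = (R \<union> S)\<^sup>+"
proof
  show "(rel_join R S)\<^sup>+ \<subseteq> (R \<union> S)\<^sup>+"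
    using trancl_mono[of _ "rel_join R S" "(R \<union> S)\<^sup>+"] by (auto simp: rel_join_def)
  assume "R \<subseteq> A" "S \<subseteq> A"
  then have "R \<union> S \<subseteq> rel_join R S" by (auto simp: rel_join_def)
  then show "(R \<union> S)\<^sup>+ \<subseteq> (rel_join R S)\<^sup>+" using trancl_mono by blast
qed

text \<open>Both halves of a path can be kept among the inner vertices and endpoints, so the chain
  property can be applied to a vertex set containing nothing else.\<close>

lemma trancl_Restr_between:
  assumes "(u, p) \<in> B\<^sup>+" "(p, v) \<in> B\<^sup>+"
  shows "(u, p) \<in> (Restr B ({z. (u, z) \<in> B\<^sup>+ \<and> (z, v) \<in> B\<^sup>+} \<union> {u, v}))\<^sup>*"
    "(p, v) \<in> (Restr B ({z. (u, z) \<in> B\<^sup>+ \<and> (z, v) \<in> B\<^sup>+} \<union> {u, v}))\<^sup>*"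
proof -
  let ?W = "{z. (u, z) \<in> B\<^sup>+ \<and> (z, v) \<in> B\<^sup>+} \<union> {u, v}"
  show "(u, p) \<in> (Restr B ?W)\<^sup>*"
    using assms
  proof (induction rule: trancl_induct)
    case (base y)
    then show ?case by auto
  next
    case (step y z)
    then have "(y, v) \<in> B\<^sup>+" by (meson trancl_into_trancl2)
    then have "(y, z) \<in> Restr B ?W" using step by (auto intro: trancl_into_trancl)
    then show ?case using step \<open>(y, v) \<in> B\<^sup>+\<close> by (meson rtrancl.rtrancl_into_rtrancl)
  qed
  show "(p, v) \<in> (Restr B ?W)\<^sup>*"
    using assms(2,1)
  proof (induction rule: converse_trancl_induct)
    case (base y)
    then show ?case by auto
  next
    case (step y z)
    then have "(u, z) \<in> B\<^sup>+" by (meson trancl_into_trancl)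
    then have "(y, z) \<in> Restr B ?W" using step by (auto intro: trancl_into_trancl2)
    then show ?case using step \<open>(u, z) \<in> B\<^sup>+\<close> by (meson converse_rtrancl_into_rtrancl)
  qed
qed

text \<open>Paths through the join and through its complement with the same endpoints have no common
  inner vertex (by induction on the interval). Since the vertices of both paths
  form a chain, some arc connects an inner vertex of one to an inner vertex of the other;
  wherever this arc lies, it gives two such paths in a smaller interval.\<close>

lemma rel_join_biclosed:
  assumes R: "biclosed R" and S: "biclosed S"
  shows "biclosed (rel_join R S)"
proof -
  define X where "X = rel_join R S"
  define B where "B = A - X"
  have sub: "R \<subseteq> X" "S \<subseteq> X" "X \<subseteq> A" "B \<subseteq> A"
    using biclosedD(1)[OF R] biclosedD(1)[OF S] by (auto simp: X_def rel_join_def B_def)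
  have X: "X\<^sup>+ = (R \<union> S)\<^sup>+" using R S biclosedD(1) by (simp add: X_def trancl_rel_join)
  have "False" if "(u, v) \<in> X\<^sup>+" "(u, v) \<in> B\<^sup>+" for u v
    using that
  proof (induction "card (between u v)" arbitrary: u v rule: less_induct)
    case less
    have XA: "(a, b) \<in> A\<^sup>+" if "(a, b) \<in> X\<^sup>+" for a b using that sub trancl_mono by blast
    have BA: "(a, b) \<in> A\<^sup>+" if "(a, b) \<in> B\<^sup>+" for a b using that sub trancl_mono by blast
    have IH1: False if "(u, w) \<in> X\<^sup>+" "(u, w) \<in> B\<^sup>+" "(w, v) \<in> A\<^sup>+" for w
      using less(1)[OF psubset_card_mono[OF finite_between between_psubset2]] that XA
      by (meson trancl_into_rtrancl)
    have IH2: False if "(w, v) \<in> X\<^sup>+" "(w, v) \<in> B\<^sup>+" "(u, w) \<in> A\<^sup>+" for w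
      using less(1)[OF psubset_card_mono[OF finite_between between_psubset1]] that XA
      by (meson trancl_into_rtrancl)
    define P where "P = {z. (u, z) \<in> B\<^sup>+ \<and> (z, v) \<in> B\<^sup>+}"
    define Q where "Q = {z. (u, z) \<in> X\<^sup>+ \<and> (z, v) \<in> X\<^sup>+}"
    have PQ: "P \<inter> Q = {}" using IH1 XA by (auto simp: P_def Q_def)
    have "(u, v) \<notin> B"
    proof
      assume "(u, v) \<in> B"
      then have "(u, v) \<in> A" "(u, v) \<notin> X" by (auto simp: B_def)
      then show False using less(2) X by (simp add: X_def rel_join_def)
    qed
    then obtain p where p: "p \<in> P"
      using less(3) by (auto simp: P_def elim: tranclE)
    \<comment> \<open>The path in \<open>B\<close> avoids both \<open>R\<close> and
      \<open>S\<close>, so biclosedness of the two excludes this arc. Since \<open>X\<close> and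
      \<open>R \<union> S\<close> have the same reachability, the path through \<open>X\<close> then
      has an inner vertex, even if \<open>(u, v)\<close> is an arc of \<open>X\<close>.\<close>
    have "(u, v) \<notin> R \<union> S"
    proof
      assume a: "(u, v) \<in> R \<union> S"
      have "(u, v) \<in> (A - R)\<^sup>+" "(u, v) \<in> (A - S)\<^sup>+"
        using less(3) sub by (auto simp: B_def elim!: trancl_mono)
      then show False using a biclosedD(2)[OF R, of u v] biclosedD(2)[OF S, of u v] by auto
    qed
    then obtain q where q: "q \<in> Q"
      using less(2) unfolding X Q_def by (auto elim: tranclE)
    \<comment> \<open>Besides the endpoints, \<open>W\<close> has only inner vertices of the two
      kinds, so an arc of a path from \<open>p\<close> to \<open>q\<close> that leaves
      \<open>P\<close> must end in \<open>Q\<close>.\<close>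
    define W where "W = P \<union> Q \<union> {u, v}"
    have "(Restr B (P \<union> {u, v}))\<^sup>* \<subseteq> (Restr A W)\<^sup>*" "(Restr X (Q \<union> {u, v}))\<^sup>* \<subseteq> (Restr A W)\<^sup>*"
      using sub by (auto simp: W_def intro!: rtrancl_mono)
    then have "(u, p) \<in> (Restr A W)\<^sup>*" "(p, v) \<in> (Restr A W)\<^sup>*"
      "(u, q) \<in> (Restr A W)\<^sup>*" "(q, v) \<in> (Restr A W)\<^sup>*"
      using p q trancl_Restr_between[of u p B v] trancl_Restr_between[of u q X v]
      by (auto simp: P_def Q_def)
    then have c: "(p, q) \<in> (Restr A W)\<^sup>* \<or> (q, p) \<in> (Restr A W)\<^sup>*"
      by (rule interval_chain)
    have inner: "(u, z) \<in> A\<^sup>+" "(z, v) \<in> A\<^sup>+" if "z \<in> P \<union> Q" for z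
      using that XA BA by (auto simp: P_def Q_def)
    have WA: "(a, b) \<in> A\<^sup>*" if "(a, b) \<in> (Restr A W)\<^sup>*" for a b
      using that rtrancl_mono[of "Restr A W" A] by auto
    have qP: "q \<notin> P" and pQ: "p \<notin> Q" using p q PQ by auto
    from c show False
    proof
      assume "(p, q) \<in> (Restr A W)\<^sup>*"
      from rtrancl_exits[OF this p qP] obtain x y where xy: "(x, y) \<in> Restr A W" "x \<in> P" "y \<notin> P"
        "(y, q) \<in> (Restr A W)\<^sup>*" by blast
      have "y \<noteq> u" using xy inner(1)[of x] less_not_le by auto
      moreover have "y \<noteq> v" using WA[OF xy(4)] inner(2)[of q] q less_not_le by auto
      ultimately have y: "y \<in> Q" using xy by (auto simp: W_def)
      show False
      proof (cases "(x, y) \<in> X")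
        case True
        then show False using IH2[of x] xy(2) y inner(1)[of x]
          by (auto simp: P_def Q_def intro: trancl_into_trancl2)
      next
        case False
        then have "(x, y) \<in> B" using xy by (auto simp: B_def)
        then show False using IH1[of y] xy(2) y inner(2)[of y]
          by (auto simp: P_def Q_def intro: trancl_into_trancl)
      qed
    next
      assume "(q, p) \<in> (Restr A W)\<^sup>*"
      from rtrancl_exits[OF this q pQ] obtain x y where xy: "(x, y) \<in> Restr A W" "x \<in> Q" "y \<notin> Q"
        "(y, p) \<in> (Restr A W)\<^sup>*" by blast
      have "y \<noteq> u" using xy inner(1)[of x] less_not_le by auto
      moreover have "y \<noteq> v" using WA[OF xy(4)] inner(2)[of p] p less_not_le by auto
      ultimately have y: "y \<in> P" using xy by (auto simp: W_def)
      show False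
      proof (cases "(x, y) \<in> X")
        case True
        then show False using IH1[of y] xy(2) y inner(2)[of y]
          by (auto simp: P_def Q_def intro: trancl_into_trancl)
      next
        case False
        then have "(x, y) \<in> B" using xy by (auto simp: B_def)
        then show False using IH2[of x] xy(2) y inner(1)[of x]
          by (auto simp: P_def Q_def intro: trancl_into_trancl2)
      qed
    qed
  qed
  then show ?thesis using sub by (auto simp: biclosed_def X_def B_def)
qed

lemma rel_meet_biclosed: "biclosed R \<Longrightarrow> biclosed S \<Longrightarrow> biclosed (rel_meet R S)"
  unfolding rel_meet_def by (intro biclosed_compl rel_join_biclosed)

lemma rel_join_upper: "biclosed R \<Longrightarrow> biclosed S \<Longrightarrow> R \<subseteq> rel_join R S" "biclosed R \<Longrightarrow> biclosed S \<Longrightarrow> S \<subseteq> rel_join R S"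
  using biclosedD(1) by (auto simp: rel_join_def)

lemma rel_join_least: "biclosed Z \<Longrightarrow> R \<subseteq> Z \<Longrightarrow> S \<subseteq> Z \<Longrightarrow> rel_join R S \<subseteq> Z"
  using biclosed_closed trancl_mono[of _ "R \<union> S" Z] by (auto simp: rel_join_def)

lemma rel_meet_lower: "biclosed R \<Longrightarrow> biclosed S \<Longrightarrow> rel_meet R S \<subseteq> R" "biclosed R \<Longrightarrow> biclosed S \<Longrightarrow> rel_meet R S \<subseteq> S"
  using rel_join_upper[of "A - R" "A - S"] biclosed_compl by (auto simp: rel_meet_def)

lemma rel_meet_greatest:
  assumes "biclosed Z" "Z \<subseteq> R" "Z \<subseteq> S"
  shows "Z \<subseteq> rel_meet R S"
proof -
  have "rel_join (A - R) (A - S) \<subseteq> A - Z" by (rule rel_join_least) (use assms biclosed_compl in auto)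
  then show ?thesis using biclosedD(1)[OF assms(1)] by (auto simp: rel_meet_def)
qed

sublocale AR: finite_lattice "acyclic_reorientations D"
  rewrites "carrier (acyclic_reorientations D) = {R. biclosed R}"
    and "le (acyclic_reorientations D) = (\<subseteq>)"
    and "eq (acyclic_reorientations D) = (=)"
proof -
  let ?L = "acyclic_reorientations D"
  note simps = AR_simps
  show "carrier ?L = {R. biclosed R}" "le ?L = (\<subseteq>)" "eq ?L = (=)"
    by (simp_all only: simps)
  have "{R. biclosed R} \<subseteq> Pow A" using biclosedD(1) by auto
  then have "finite {R. biclosed R}" using finite_arcs finite_subset by blast
  moreover have "\<exists>s. least ?L s (Upper ?L {x, y})" if "biclosed x" "biclosed y" for x y
    by (rule exI[of _ "rel_join x y"])
      (use that rel_join_biclosed rel_join_upper rel_join_least in \<open>auto simp: least_def Upper_def simps\<close>)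
  moreover have "\<exists>s. greatest ?L s (Lower ?L {x, y})" if "biclosed x" "biclosed y" for x y
    by (rule exI[of _ "rel_meet x y"])
      (use that rel_meet_biclosed rel_meet_lower rel_meet_greatest in \<open>auto simp: greatest_def Lower_def simps\<close>)
  ultimately show "finite_lattice ?L"
    by unfold_locales (auto simp: simps)
qed

lemma AR_join: "biclosed R \<Longrightarrow> biclosed S \<Longrightarrow> R \<squnion>\<^bsub>acyclic_reorientations D\<^esub> S = rel_join R S"
  by (intro equalityI AR.join_le rel_join_least rel_join_upper)
    (auto simp: rel_join_biclosed rel_join_upper AR.join_left AR.join_right
      intro: AR.join_closed[simplified])

lemma AR_meet: "biclosed R \<Longrightarrow> biclosed S \<Longrightarrow> R \<sqinter>\<^bsub>acyclic_reorientations D\<^esub> S = rel_meet R S"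
  by (intro equalityI AR.meet_le rel_meet_greatest rel_meet_lower)
    (auto simp: rel_meet_biclosed rel_meet_lower AR.meet_left AR.meet_right
      intro: AR.meet_closed[simplified])

text \<open>Among the arcs of \<open>S - R\<close>, reverse one whose interval in the reorientation
  \<open>E\<close> of \<open>R\<close> is smallest. If this created a cycle, \<open>E\<close> would
  have another path from \<open>u\<close> to \<open>v\<close>; as \<open>v\<close> precedes
  \<open>u\<close> in the acyclic reorientation \<open>F\<close> of \<open>S\<close>, this path uses
  an arc on which \<open>E\<close> and \<open>F\<close> differ, and that arc has a smaller
  interval.\<close>

lemma biclosed_insert:
  assumes R: "biclosed R" and S: "biclosed S" and RS: "R \<subset> S"
  shows "\<exists>a \<in> S - R. biclosed (insert a R)"
proof -
  define E where "E = A - R \<union> R\<inverse>"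
  define F where "F = A - S \<union> S\<inverse>"
  have acE: "acyclic E" and acF: "acyclic F"
    unfolding E_def F_def using R S biclosedD(1) biclosed_iff_acyclic by blast+
  define I where "I = (\<lambda>(u, v). {z. (u, z) \<in> E\<^sup>* \<and> (z, v) \<in> E\<^sup>*})"
  have fin: "finite (I a)" for a
  proof -
    have "I a \<subseteq> insert (fst a) (Range E)"
      by (cases a) (auto simp: I_def elim: rtranclE)
    moreover have "finite E" unfolding E_def using finite_arcs biclosedD(1)[OF R] finite_subset by auto
    ultimately show ?thesis by (meson finite_Range finite_insert finite_subset)
  qed
  obtain a where a: "a \<in> S - R" and min: "\<And>b. b \<in> S - R \<Longrightarrow> card (I a) \<le> card (I b)"
  proof -
    have "\<exists>a. is_arg_min (\<lambda>a. card (I a)) (\<lambda>a. a \<in> S - R) a"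
      using RS ex_has_least_nat[of "\<lambda>a. a \<in> S - R" _ "\<lambda>a. card (I a)"]
      by (auto simp: is_arg_min_linorder)
    then show thesis using that unfolding is_arg_min_linorder by blast
  qed
  obtain u v where uv: "a = (u, v)" by fastforce
  have aA: "(u, v) \<in> A" "(u, v) \<notin> R" using a uv biclosedD(1)[OF S] by auto
  have E': "A - insert a R \<union> (insert a R)\<inverse> = insert (v, u) (E - {(u, v)})"
  proof -
    have "(v, u) \<notin> R" using aA biclosedD(1)[OF R] less_not_le[of u v] by auto
    then show ?thesis using aA by (auto simp: E_def uv)
  qed
  have "(u, v) \<notin> (E - {(u, v)})\<^sup>*"
  proof
    assume path: "(u, v) \<in> (E - {(u, v)})\<^sup>*"
    have "(u, v) \<notin> F\<^sup>*"
    proof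
      assume "(u, v) \<in> F\<^sup>*"
      moreover have "(v, u) \<in> F" using a uv by (auto simp: F_def)
      ultimately show False using acF by (meson acyclic_def rtrancl_into_trancl2)
    qed
    from rtrancl_leaves[OF path this] obtain x y where xy: "(x, y) \<in> E - {(u, v)} - F"
      "(u, x) \<in> (E - {(u, v)})\<^sup>*" "(y, v) \<in> (E - {(u, v)})\<^sup>*" by blast
    have sub: "(E - {(u, v)})\<^sup>* \<subseteq> E\<^sup>*" by (rule rtrancl_mono) auto
    have ux: "(u, x) \<in> E\<^sup>*" "(y, v) \<in> E\<^sup>*" "(x, y) \<in> E" "(x, y) \<noteq> (u, v)" using xy sub by auto
    have "(x, y) \<in> S - R" using xy RS by (auto simp: E_def F_def)
    have le: "b = c" if "(b, c) \<in> E\<^sup>*" "(c, b) \<in> E\<^sup>*" for b c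
      using that acE by (meson acyclic_def rtranclD trancl_rtrancl_trancl)
    have "I (x, y) \<subset> I (u, v)"
    proof
      show "I (x, y) \<subseteq> I (u, v)" using ux by (auto simp: I_def)
      have uv': "(u, v) \<in> E\<^sup>*" using aA by (auto simp: E_def)
      \<comment> \<open>Containing both endpoints would force \<open>x = u\<close> and
        \<open>y = v\<close> by antisymmetry of \<open>E\<close>.\<close>
      have "u \<notin> I (x, y) \<or> v \<notin> I (x, y)" using ux le by (auto simp: I_def)
      moreover have "u \<in> I (u, v)" "v \<in> I (u, v)" using uv' by (auto simp: I_def)
      ultimately show "I (x, y) \<noteq> I (u, v)" by blast
    qed
    then have "card (I (x, y)) < card (I a)" using fin uv by (auto intro: psubset_card_mono)
    then show False using min[OF \<open>(x, y) \<in> S - R\<close>] by simp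
  qed
  moreover have "acyclic (E - {(u, v)})" using acE by (rule acyclic_subset) auto
  ultimately have "acyclic (A - insert a R \<union> (insert a R)\<inverse>)"
    unfolding E' by (simp add: acyclic_insert)
  then have "biclosed (insert a R)"
    using biclosed_iff_acyclic[of "insert a R"] biclosedD(1)[OF R] aA uv by auto
  then show ?thesis using a by blast
qed

lemma biclosed_remove:
  assumes R: "biclosed R" and S: "biclosed S" and RS: "R \<subset> S"
  shows "\<exists>a \<in> S - R. biclosed (S - {a})"
proof -
  have "A - S \<subset> A - R" using RS biclosedD(1)[OF S] by auto
  then obtain a where a: "a \<in> (A - R) - (A - S)" "biclosed (insert a (A - S))"
    using biclosed_insert[OF biclosed_compl[OF S] biclosed_compl[OF R]] by blast
  have "A - insert a (A - S) = S - {a}" using biclosedD(1)[OF S] by auto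
  then have "biclosed (S - {a})" using biclosed_compl[OF a(2)] by simp
  then show ?thesis using a by blast
qed

lemma covers_insert:
  assumes "covers (acyclic_reorientations D) S R"
  obtains a where "a \<notin> R" "S = insert a R" "biclosed R" "biclosed S"
proof -
  have RS: "biclosed R" "biclosed S" "R \<subset> S" and no: "\<And>Z. biclosed Z \<Longrightarrow> R \<subset> Z \<Longrightarrow> Z \<subset> S \<Longrightarrow> False"
    using assms by (auto simp: covers_def lless_def AR_simps)
  obtain a where a: "a \<in> S - R" "biclosed (insert a R)" using biclosed_insert[OF RS] by blast
  then have "S = insert a R" using no[OF a(2)] RS(3) by blast
  then show thesis using that a RS by blast
qed

lemma covers_insertI:
  assumes "biclosed R" "biclosed (insert a R)" "a \<notin> R"
  shows "covers (acyclic_reorientations D) (insert a R) R"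
  using assms by (auto simp: covers_def lless_def AR_simps)

end

section \<open>Congruences of finite lattices\<close>

context finite_lattice
begin

lemma lless_iff: "x \<sqsubset> y \<longleftrightarrow> x \<sqsubseteq> y \<and> x \<noteq> y"
  by (simp add: lless_def eq_is_equal)

lemma card_down_less:
  assumes "x \<in> carrier L" "y \<in> carrier L" "x \<sqsubset> y"
  shows "card {w \<in> carrier L. w \<sqsubseteq> x} < card {w \<in> carrier L. w \<sqsubseteq> y}"
proof (rule psubset_card_mono)
  have "y \<notin> {w \<in> carrier L. w \<sqsubseteq> x}" using assms le_antisym by (auto simp: lless_iff)
  then show "{w \<in> carrier L. w \<sqsubseteq> x} \<subset> {w \<in> carrier L. w \<sqsubseteq> y}"
    using assms le_trans by (auto simp: lless_iff)
qed (simp add: finite_carrier)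

lemma minimal_element:
  assumes "x \<in> carrier L" "P x"
  obtains m where "m \<in> carrier L" "P m" "m \<sqsubseteq> x" "\<And>w. \<lbrakk>w \<in> carrier L; w \<sqsubset> m\<rbrakk> \<Longrightarrow> \<not> P w"
proof -
  have "\<exists>m. (m \<in> carrier L \<and> P m \<and> m \<sqsubseteq> x) \<and> (\<forall>w \<in> carrier L. w \<sqsubset> m \<longrightarrow> \<not> P w)"
    using assms
  proof (induction "card {w \<in> carrier L. w \<sqsubseteq> x}" arbitrary: x rule: less_induct)
    case less
    show ?case
    proof (cases "\<exists>w \<in> carrier L. w \<sqsubset> x \<and> P w")
      case True
      then obtain w where w: "w \<in> carrier L" "w \<sqsubset> x" "P w" by blast
      then obtain m where "(m \<in> carrier L \<and> P m \<and> m \<sqsubseteq> w) \<and> (\<forall>w \<in> carrier L. w \<sqsubset> m \<longrightarrow> \<not> P w)"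
        using less(1)[OF card_down_less] less(2) by blast
      then show ?thesis using w less(2) le_trans by (auto simp: lless_iff intro!: exI[of _ m])
    next
      case False
      then show ?thesis using less le_refl by blast
    qed
  qed
  then show thesis using that by blast
qed

lemma join_irreducibleI:
  assumes "i \<in> carrier L" "j \<in> carrier L" "i \<sqsubset> j"
    and "\<And>w. \<lbrakk>w \<in> carrier L; w \<sqsubset> j\<rbrakk> \<Longrightarrow> w \<sqsubseteq> i"
  shows "j \<in> join_irreducibles L" "lower_cover L j = i"
proof -
  have c: "covers L j i"
    using assms le_antisym by (auto simp: covers_def lless_iff)
  moreover have u: "w = i" if "covers L j w" for w
    using that assms by (auto simp: covers_def lless_iff)
  ultimately have "\<exists>!i. covers L j i" by blast
  then show "j \<in> join_irreducibles L" using assms(2) by (simp add: join_irreducibles_def)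
  show "lower_cover L j = i" unfolding lower_cover_def by (rule the_equality) (fact c, fact u)
qed

lemma covers_between':
  assumes "x \<in> carrier L" "y \<in> carrier L" "x \<sqsubset> y"
  obtains z where "covers L y z" "x \<sqsubseteq> z"
proof -
  have "\<exists>z. covers L y z \<and> x \<sqsubseteq> z"
    using assms
  proof (induction "card {w \<in> carrier L. w \<sqsubseteq> y} - card {w \<in> carrier L. w \<sqsubseteq> x}"
      arbitrary: x rule: less_induct)
    case less
    show ?case
    proof (cases "covers L y x")
      case True
      then show ?thesis using less by auto
    next
      case False
      then obtain w where w: "w \<in> carrier L" "x \<sqsubset> w" "w \<sqsubset> y" using less by (auto simp: covers_def)
      have "card {v \<in> carrier L. v \<sqsubseteq> x} < card {v \<in> carrier L. v \<sqsubseteq> w}"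
        "card {v \<in> carrier L. v \<sqsubseteq> w} < card {v \<in> carrier L. v \<sqsubseteq> y}"
        using w less card_down_less by blast+
      then have "card {v \<in> carrier L. v \<sqsubseteq> y} - card {v \<in> carrier L. v \<sqsubseteq> w} <
          card {v \<in> carrier L. v \<sqsubseteq> y} - card {v \<in> carrier L. v \<sqsubseteq> x}" by linarith
      then obtain z where "covers L y z" "w \<sqsubseteq> z" using less(1)[of w] w less(3) by blast
      then show ?thesis using w less le_trans[of x w z] by (auto simp: covers_def lless_iff)
    qed
  qed
  then show thesis using that by blast
qed

lemma join_irreducibleD:
  assumes j: "j \<in> join_irreducibles L"
  shows "covers L j (lower_cover L j)" "j \<in> carrier L" "lower_cover L j \<in> carrier L"
    "lower_cover L j \<sqsubset> j" "\<lbrakk>w \<in> carrier L; w \<sqsubset> j\<rbrakk> \<Longrightarrow> w \<sqsubseteq> lower_cover L j"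
proof -
  have ex: "\<exists>!i. covers L j i" using j by (simp add: join_irreducibles_def)
  then show c: "covers L j (lower_cover L j)" unfolding lower_cover_def by (rule theI')
  then show j': "j \<in> carrier L" "lower_cover L j \<in> carrier L" "lower_cover L j \<sqsubset> j"
    by (auto simp: covers_def)
  show "w \<sqsubseteq> lower_cover L j" if w: "w \<in> carrier L" "w \<sqsubset> j"
    using covers_between'[OF w(1) j'(1) w(2)] ex c by metis
qed

section \<open>Principal congruences and perspectivity\<close>

lemma principal_congruence:
  assumes "x \<in> carrier L" "y \<in> carrier L"
  shows "lattice_congruence L (principal_congruence L x y)"
    "(x, y) \<in> principal_congruence L x y"
    "\<lbrakk>lattice_congruence L \<theta>; (x, y) \<in> \<theta>\<rbrakk> \<Longrightarrow> principal_congruence L x y \<subseteq> \<theta>"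
  using least_principal_congruence[OF assms] by (auto simp: least_def congruence_lattice_def)

lemma principal_congruence_eq_iff:
  assumes "x \<in> carrier L" "y \<in> carrier L" "x' \<in> carrier L" "y' \<in> carrier L"
  shows "principal_congruence L x y = principal_congruence L x' y' \<longleftrightarrow>
    (\<forall>\<theta>. lattice_congruence L \<theta> \<longrightarrow> (x, y) \<in> \<theta> \<longleftrightarrow> (x', y') \<in> \<theta>)"
  using principal_congruence[OF assms(1,2)] principal_congruence[OF assms(3,4)] by blast

lemma lattice_congruenceD:
  assumes "lattice_congruence L \<theta>"
  shows "equiv (carrier L) \<theta>" "(x, y) \<in> \<theta> \<Longrightarrow> x \<in> carrier L" "(x, y) \<in> \<theta> \<Longrightarrow> y \<in> carrier L"
    "x \<in> carrier L \<Longrightarrow> (x, x) \<in> \<theta>" "(x, y) \<in> \<theta> \<Longrightarrow> (y, x) \<in> \<theta>"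
    "(x, y) \<in> \<theta> \<Longrightarrow> (y, z) \<in> \<theta> \<Longrightarrow> (x, z) \<in> \<theta>"
    "(x, y) \<in> \<theta> \<Longrightarrow> z \<in> carrier L \<Longrightarrow> (x \<squnion> z, y \<squnion> z) \<in> \<theta>"
    "(x, y) \<in> \<theta> \<Longrightarrow> z \<in> carrier L \<Longrightarrow> (x \<sqinter> z, y \<sqinter> z) \<in> \<theta>"
proof -
  show e: "equiv (carrier L) \<theta>" using assms by (simp add: lattice_congruence_def)
  then show "(x, y) \<in> \<theta> \<Longrightarrow> x \<in> carrier L" "(x, y) \<in> \<theta> \<Longrightarrow> y \<in> carrier L"
    and r: "z \<in> carrier L \<Longrightarrow> (z, z) \<in> \<theta>" and "(x, y) \<in> \<theta> \<Longrightarrow> (y, x) \<in> \<theta>"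
    "(x, y) \<in> \<theta> \<Longrightarrow> (y, z) \<in> \<theta> \<Longrightarrow> (x, z) \<in> \<theta>" for z
    unfolding equiv_def refl_on_def sym_def trans_def by blast+
  show "(x, y) \<in> \<theta> \<Longrightarrow> z \<in> carrier L \<Longrightarrow> (x \<squnion> z, y \<squnion> z) \<in> \<theta>"
    "(x, y) \<in> \<theta> \<Longrightarrow> z \<in> carrier L \<Longrightarrow> (x \<sqinter> z, y \<sqinter> z) \<in> \<theta>"
    using assms r[of z] by (auto simp: lattice_congruence_def)
qed

lemma meet_absorb: "x \<in> carrier L \<Longrightarrow> y \<in> carrier L \<Longrightarrow> x \<sqsubseteq> y \<Longrightarrow> x \<sqinter> y = x"
  "x \<in> carrier L \<Longrightarrow> y \<in> carrier L \<Longrightarrow> x \<sqsubseteq> y \<Longrightarrow> y \<sqinter> x = x"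
  by (metis le_iff_join meet_comm)+

lemma join_absorb: "x \<in> carrier L \<Longrightarrow> y \<in> carrier L \<Longrightarrow> x \<sqsubseteq> y \<Longrightarrow> x \<squnion> y = y"
  "x \<in> carrier L \<Longrightarrow> y \<in> carrier L \<Longrightarrow> x \<sqsubseteq> y \<Longrightarrow> y \<squnion> x = y"
  by (metis le_iff_meet join_comm)+

text \<open>Joining with \<open>y\<close> carries the first pair to the second, and meeting with
  \<open>x\<close> carries it back.\<close>

lemma principal_congruence_perspective:
  assumes "x \<in> carrier L" "y \<in> carrier L"
  shows "principal_congruence L (x \<sqinter> y) x = principal_congruence L y (x \<squnion> y)"
proof (subst principal_congruence_eq_iff, simp_all add: assms, intro allI impI)
  fix \<theta> assume \<theta>: "lattice_congruence L \<theta>"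
  note D = lattice_congruenceD[OF \<theta>]
  show "(x \<sqinter> y, x) \<in> \<theta> \<longleftrightarrow> (y, x \<squnion> y) \<in> \<theta>"
  proof
    assume "(x \<sqinter> y, x) \<in> \<theta>"
    from D(7)[OF this assms(2)] show "(y, x \<squnion> y) \<in> \<theta>"
      using assms by (simp add: join_absorb meet_right)
  next
    assume "(y, x \<squnion> y) \<in> \<theta>"
    from D(8)[OF this assms(1)] show "(x \<sqinter> y, x) \<in> \<theta>"
      using assms meet_comm[of L y x] by (simp add: meet_absorb join_left)
  qed
qed

text \<open>Take \<open>j\<close> minimal among the elements below \<open>y\<close> but not below
  \<open>x\<close>. Everything strictly below \<open>j\<close> is then below
  \<open>j \<sqinter> x\<close>, which is therefore its unique lower cover, and
  \<open>j \<squnion> x = y\<close> because \<open>y\<close> covers \<open>x\<close>.\<close>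

lemma covers_perspective_join_irreducible:
  assumes c: "covers L y x"
  obtains j where "j \<in> join_irreducibles L" "j \<sqsubseteq> y"
    "principal_congruence L (lower_cover L j) j = principal_congruence L x y"
proof -
  have xy: "x \<in> carrier L" "y \<in> carrier L" "x \<sqsubset> y"
    and no: "\<And>z. z \<in> carrier L \<Longrightarrow> x \<sqsubset> z \<Longrightarrow> z \<sqsubset> y \<Longrightarrow> False"
    using c by (auto simp: covers_def)
  have "\<not> y \<sqsubseteq> x" using xy le_antisym by (auto simp: lless_iff)
  then obtain j where j: "j \<in> carrier L" "\<not> j \<sqsubseteq> x" "j \<sqsubseteq> y"
    and min: "\<And>w. \<lbrakk>w \<in> carrier L; w \<sqsubset> j\<rbrakk> \<Longrightarrow> \<not> \<not> w \<sqsubseteq> x"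
    using xy by (elim minimal_element[of y "\<lambda>j. \<not> j \<sqsubseteq> x"]) auto
  have m: "j \<sqinter> x \<in> carrier L" "j \<sqinter> x \<sqsubset> j"
    using j xy meet_left[of j x] meet_right[of j x] by (auto simp: lless_iff)
  have le: "w \<sqsubseteq> j \<sqinter> x" if "w \<in> carrier L" "w \<sqsubset> j" for w
    using that min[OF that] j xy by (auto simp: lless_iff intro: meet_le)
  have "x \<sqsubset> j \<squnion> x"
    using j xy join_left[of j x] join_right[of j x] by (auto simp: lless_iff)
  moreover have "j \<squnion> x \<sqsubseteq> y" using j xy by (auto simp: lless_iff intro: join_le)
  ultimately have "j \<squnion> x = y" using no[of "j \<squnion> x"] j xy by (auto simp: lless_iff)
  then have "principal_congruence L (j \<sqinter> x) j = principal_congruence L x y"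
    using principal_congruence_perspective[OF j(1) xy(1)] by simp
  then show thesis
    using that[of j] join_irreducibleI[OF m(1) j(1) m(2) le] j(3) by simp
qed

section \<open>Join irreducible congruences\<close>

lemma congruence_lattice_simps:
  "carrier (congruence_lattice L) = {\<theta>. lattice_congruence L \<theta>}"
  "x \<sqsubset>\<^bsub>congruence_lattice L\<^esub> y \<longleftrightarrow> x \<subset> y"
  by (auto simp: congruence_lattice_def lless_def)

lemma finite_congruences: "finite {\<theta>. lattice_congruence L \<theta>}"
proof (rule finite_subset)
  show "{\<theta>. lattice_congruence L \<theta>} \<subseteq> Pow (carrier L \<times> carrier L)"
    using lattice_congruenceD(2,3) by auto
qed (simp add: finite_carrier)

text \<open>The join in the congruence lattice: translations by a fixed element act on a chain step
  by step, and two translations give compatibility in both arguments.\<close>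

lemma trancl_Union_congruence:
  assumes ne: "C \<noteq> {}" and C: "\<And>\<psi>. \<psi> \<in> C \<Longrightarrow> lattice_congruence L \<psi>"
  shows "lattice_congruence L ((\<Union>C)\<^sup>+)"
proof -
  let ?t = "(\<Union>C)\<^sup>+"
  have car: "x \<in> carrier L \<and> y \<in> carrier L" if "(x, y) \<in> ?t" for x y
    using that by (induction rule: trancl_induct) (use C lattice_congruenceD(2,3) in blast)+
  have r: "(x, x) \<in> ?t" if "x \<in> carrier L" for x
    using ne C lattice_congruenceD(4) that by (meson UnionI ex_in_conv r_into_trancl)
  have "sym (\<Union>C)" using C lattice_congruenceD(5) unfolding sym_def by blast
  then have "sym ?t" by (rule sym_trancl)
  then have e: "equiv (carrier L) ?t"
    using r car unfolding equiv_def refl_on_def by (auto intro: trans_trancl)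
  have j: "(x \<squnion> z, y \<squnion> z) \<in> ?t" and m: "(x \<sqinter> z, y \<sqinter> z) \<in> ?t"
    if "(x, y) \<in> ?t" "z \<in> carrier L" for x y z
    using that(1)
    by (induction rule: trancl_induct)
      (use that(2) C lattice_congruenceD(7,8) in \<open>blast intro: trancl_into_trancl\<close>)+
  have "(x \<squnion> y, x' \<squnion> y') \<in> ?t \<and> (x \<sqinter> y, x' \<sqinter> y') \<in> ?t"
    if "(x, x') \<in> ?t" "(y, y') \<in> ?t" for x x' y y'
    using j[OF that(1), of y] j[OF that(2), of x'] m[OF that(1), of y] m[OF that(2), of x']
      car[OF that(1)] car[OF that(2)] join_comm[of L] meet_comm[of L] by (metis trancl_trans)
  then show ?thesis using e by (simp add: lattice_congruence_def)
qed

text \<open>The union of all congruences strictly below con(x,y) generates a congruence that still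
  separates x and y, since the retraction of L onto the two-element interval between x
  and y respects every congruence.\<close>

lemma principal_congruence_cover_irreducible:
  assumes c: "covers L y x"
  shows "principal_congruence L x y \<in> join_irreducibles (congruence_lattice L)"
proof -
  have xy: "x \<in> carrier L" "y \<in> carrier L" "x \<sqsubseteq> y" "x \<noteq> y"
    and no: "\<And>z. z \<in> carrier L \<Longrightarrow> x \<sqsubset> z \<Longrightarrow> z \<sqsubset> y \<Longrightarrow> False"
    using c by (auto simp: covers_def lless_iff)
  let ?\<theta> = "principal_congruence L x y"
  note \<theta> = principal_congruence[OF xy(1,2)]
  define C where "C = {\<psi>. lattice_congruence L \<psi> \<and> \<psi> \<subset> ?\<theta>}"
  have CC: "lattice_congruence L \<psi>" "\<psi> \<subset> ?\<theta>" "(x, y) \<notin> \<psi>" if "\<psi> \<in> C" for \<psi>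
    using that \<theta>(3) by (auto simp: C_def)
  have "Id_on (carrier L) \<in> C"
  proof -
    have "lattice_congruence L (Id_on (carrier L))"
      by (auto simp: lattice_congruence_def equiv_def refl_on_def sym_def trans_def)
    moreover have "Id_on (carrier L) \<subseteq> ?\<theta>" using lattice_congruenceD(4)[OF \<theta>(1)] by auto
    moreover have "(x, y) \<notin> Id_on (carrier L)" using xy(4) by blast
    ultimately show ?thesis using \<theta>(2) unfolding C_def by blast
  qed
  then have ne: "C \<noteq> {}" by blast
  let ?t = "(\<Union>C)\<^sup>+"
  have t: "lattice_congruence L ?t" using trancl_Union_congruence[OF ne] CC by blast
  have tsub: "?t \<subseteq> ?\<theta>"
  proof -
    have "(a, b) \<in> ?\<theta>" if "(a, b) \<in> ?t" for a b
      using that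
    proof (induction rule: trancl_induct)
      case (base b)
      then show ?case using CC(2) by blast
    next
      case (step b c)
      then show ?case using CC(2) lattice_congruenceD(6)[OF \<theta>(1)] by blast
    qed
    then show ?thesis by auto
  qed
  define h where "h z = (z \<squnion> x) \<sqinter> y" for z
  have h: "h z = x \<or> h z = y" if "z \<in> carrier L" for z
  proof -
    have "h z \<in> carrier L" "x \<sqsubseteq> h z" "h z \<sqsubseteq> y"
      using that xy by (auto simp: h_def intro: meet_le join_right meet_right)
    then show ?thesis using no[of "h z"] by (auto simp: lless_iff)
  qed
  have hs: "h a = h b" if ab: "(a, b) \<in> \<Union>C" for a b
  proof -
    obtain \<psi> where \<psi>: "\<psi> \<in> C" "(a, b) \<in> \<psi>" using ab by blast
    note D = lattice_congruenceD[OF CC(1)[OF \<psi>(1)]]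
    have "(h a, h b) \<in> \<psi>" unfolding h_def using \<psi>(2) D(7,8) xy by blast
    then show ?thesis using h[of a] h[of b] D(2,3)[OF \<psi>(2)] D(5) CC(3)[OF \<psi>(1)] by auto
  qed
  have "h a = h b" if "(a, b) \<in> ?t" for a b
    using that by (induction rule: trancl_induct) (metis hs)+
  moreover have "h x = x" "h y = y"
    using xy by (simp_all add: h_def join_absorb meet_absorb le_refl)
  ultimately have nt: "(x, y) \<notin> ?t" using xy(4) by metis
  \<comment> \<open>So \<open>?t\<close> is the largest congruence strictly below
    \<open>?\<theta>\<close>, hence its only lower cover.\<close>
  have "\<psi> \<subseteq> ?t" if "\<psi> \<in> C" for \<psi> using that by auto
  then have "covers (congruence_lattice L) ?\<theta> i \<longleftrightarrow> i = ?t" for i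
    using t tsub nt \<theta>(1,2) unfolding covers_def congruence_lattice_simps C_def by blast
  then show ?thesis using \<theta>(1) by (auto simp: join_irreducibles_def congruence_lattice_simps)
qed

text \<open>The unique lower cover \<open>\<phi>\<close> contains every congruence strictly below
  \<open>\<theta>\<close>. So any cover relation that \<open>\<theta>\<close> collapses and
  \<open>\<phi>\<close> does not generates all of \<open>\<theta>\<close>.\<close>

lemma join_irreducible_congruence_principal:
  assumes \<theta>: "\<theta> \<in> join_irreducibles (congruence_lattice L)"
  obtains x y where "covers L y x" "\<theta> = principal_congruence L x y"
proof -
  obtain \<phi> where \<phi>: "covers (congruence_lattice L) \<theta> \<phi>"
    and uniq: "\<And>\<psi>. covers (congruence_lattice L) \<theta> \<psi> \<Longrightarrow> \<psi> = \<phi>"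
    using \<theta> by (auto simp: join_irreducibles_def)
  have con: "lattice_congruence L \<theta>" "lattice_congruence L \<phi>" "\<phi> \<subset> \<theta>"
    using \<phi> by (auto simp: covers_def congruence_lattice_simps)
  note T = lattice_congruenceD[OF con(1)] and F = lattice_congruenceD[OF con(2)]
  have max: "\<psi> \<subseteq> \<phi>" if "lattice_congruence L \<psi>" "\<psi> \<subset> \<theta>" for \<psi>
  proof -
    have "finite {\<psi>'. lattice_congruence L \<psi>' \<and> \<psi> \<subseteq> \<psi>' \<and> \<psi>' \<subset> \<theta>}"
      using finite_congruences by (rule rev_finite_subset) auto
    from finite_has_maximal2[OF this, of \<psi>] that
    obtain \<mu> where \<mu>: "lattice_congruence L \<mu>" "\<psi> \<subseteq> \<mu>" "\<mu> \<subset> \<theta>"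
      and mx: "\<And>\<psi>'. lattice_congruence L \<psi>' \<Longrightarrow> \<psi> \<subseteq> \<psi>' \<Longrightarrow> \<psi>' \<subset> \<theta> \<Longrightarrow> \<mu> \<subseteq> \<psi>' \<Longrightarrow> \<mu> = \<psi>'"
      by (metis (no_types, lifting) mem_Collect_eq order_refl)
    have "covers (congruence_lattice L) \<theta> \<mu>"
      using \<mu> con mx unfolding covers_def congruence_lattice_simps by blast
    then show ?thesis using uniq \<mu> by blast
  qed
  obtain p q where pq: "(p, q) \<in> \<theta>" "(p, q) \<notin> \<phi>" using con(3) by auto
  have car: "p \<in> carrier L" "q \<in> carrier L" using T(2,3) pq(1) by auto
  have lo: "(p \<sqinter> q, p \<squnion> q) \<in> \<theta>"
    using T(8)[OF pq(1) car(2)] T(7)[OF pq(1) car(2)] T(5,6) car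
    by (metis join_absorb(1) le_refl meet_absorb(1))
  have nlo: "(p \<sqinter> q, p \<squnion> q) \<notin> \<phi>"
  proof
    assume a: "(p \<sqinter> q, p \<squnion> q) \<in> \<phi>"
    have "(p, p \<squnion> q) \<in> \<phi>"
      using F(7)[OF a car(1)] car by (simp add: join_absorb meet_left join_left)
    moreover have "(q, p \<squnion> q) \<in> \<phi>"
      using F(7)[OF a car(2)] car by (simp add: join_absorb meet_right join_right)
    ultimately show False using pq(2) F(5,6) by blast
  qed
  \<comment> \<open>Descend from \<open>b\<close> through covers: if \<open>\<phi>\<close> collapsed
    the top step, it would still separate \<open>a\<close> from the element below, and the induction
    continues there.\<close>
  have "\<exists>x y. covers L y x \<and> (x, y) \<in> \<theta> \<and> (x, y) \<notin> \<phi>"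
    if "a \<in> carrier L" "b \<in> carrier L" "a \<sqsubseteq> b" "(a, b) \<in> \<theta>" "(a, b) \<notin> \<phi>" for a b
    using that
  proof (induction "card {w \<in> carrier L. w \<sqsubseteq> b}" arbitrary: b rule: less_induct)
    case less
    have "a \<sqsubset> b" using less F(4) by (auto simp: lless_iff)
    then obtain z where z: "covers L b z" "a \<sqsubseteq> z" using covers_between' less by blast
    then have zc: "z \<in> carrier L" "z \<sqsubset> b" by (auto simp: covers_def)
    have zb: "(z, b) \<in> \<theta>"
      using T(7)[OF less(5) zc(1)] zc z(2) less by (simp add: join_absorb lless_iff)
    show ?case
    proof (cases "(z, b) \<in> \<phi>")
      case True
      then have "(a, z) \<notin> \<phi>" using less F(6) by blast
      moreover have "(a, z) \<in> \<theta>" using T(5,6) zb less by blast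
      ultimately show ?thesis using less(1)[of z] card_down_less zc less z by blast
    next
      case False
      then show ?thesis using z zb by blast
    qed
  qed
  from this[of "p \<sqinter> q" "p \<squnion> q"] lo nlo car
  obtain x y where c: "covers L y x" "(x, y) \<in> \<theta>" "(x, y) \<notin> \<phi>"
    using le_trans[of "p \<sqinter> q" p "p \<squnion> q"] by (auto simp: meet_left join_left)
  have xy: "x \<in> carrier L" "y \<in> carrier L" using c by (auto simp: covers_def)
  note P = principal_congruence[OF xy]
  have "principal_congruence L x y = \<theta>"
    using P(3)[OF con(1) c(2)] max[OF P(1)] P(2) c(3) by blast
  then show thesis using that c by blast
qed

text \<open>Surjectivity, for every finite lattice: a join irreducible congruence comes from a cover
  relation, and each cover relation is perspective to one below a join irreducible.\<close>

lemma join_irreducibles_congruences: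
  "(\<lambda>j. principal_congruence L (lower_cover L j) j) ` join_irreducibles L =
    join_irreducibles (congruence_lattice L)"
proof
  show "(\<lambda>j. principal_congruence L (lower_cover L j) j) ` join_irreducibles L \<subseteq>
      join_irreducibles (congruence_lattice L)"
    using join_irreducibleD(1) principal_congruence_cover_irreducible by blast
  show "join_irreducibles (congruence_lattice L) \<subseteq>
      (\<lambda>j. principal_congruence L (lower_cover L j) j) ` join_irreducibles L"
  proof
    fix \<theta> assume "\<theta> \<in> join_irreducibles (congruence_lattice L)"
    then obtain x y where "covers L y x" "\<theta> = principal_congruence L x y"
      using join_irreducible_congruence_principal by blast
    then show "\<theta> \<in> (\<lambda>j. principal_congruence L (lower_cover L j) j) ` join_irreducibles L"
      using covers_perspective_join_irreducible by (metis (no_types, lifting) image_iff)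
  qed
qed

section \<open>Duality and a criterion for congruence uniformity\<close>

lemma dual_covers: "covers (inv_gorder L) y x \<longleftrightarrow> covers L x y"
  by (auto simp: covers_def lless_def eq_is_equal)

lemma dual_irreducibles:
  "join_irreducibles (inv_gorder L) = meet_irreducibles L"
  "lower_cover (inv_gorder L) = upper_cover L"
  by (auto simp: join_irreducibles_def meet_irreducibles_def lower_cover_def upper_cover_def
      dual_covers)

lemma dual_congruence: "lattice_congruence (inv_gorder L) = lattice_congruence L"
  by (auto simp: lattice_congruence_def fun_eq_iff)

lemma dual_principal_congruence:
  "principal_congruence (inv_gorder L) x y = principal_congruence L y x"
proof -
  have "{\<theta>. lattice_congruence L \<theta> \<and> (x, y) \<in> \<theta>} = {\<theta>. lattice_congruence L \<theta> \<and> (y, x) \<in> \<theta>}"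
    using lattice_congruenceD(5) by blast
  then show ?thesis
    by (simp add: principal_congruence_def congruence_lattice_def dual_congruence)
qed

lemma meet_irreducibles_congruences:
  "(\<lambda>m. principal_congruence L m (upper_cover L m)) ` meet_irreducibles L =
    join_irreducibles (congruence_lattice L)"
proof -
  interpret dual: lattice "inv_gorder L" by (rule dual_lattice)
  interpret dual: finite_lattice "inv_gorder L"
    by unfold_locales (simp add: finite_carrier)
  show ?thesis
    using dual.join_irreducibles_congruences
    by (simp add: dual_irreducibles dual_principal_congruence congruence_lattice_def dual_congruence)
qed

text \<open>Both maps have the same finite image. If it has as many elements as there are join
  irreducibles, hence as meet irreducibles, the second map is injective too.\<close>

lemma congruence_uniformI:
  assumes inj: "inj_on (\<lambda>j. principal_congruence L (lower_cover L j) j) (join_irreducibles L)"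
    and card: "card (meet_irreducibles L) = card (join_irreducibles L)"
  shows "congruence_uniform_lattice L"
proof -
  have j: "bij_betw (\<lambda>j. principal_congruence L (lower_cover L j) j)
      (join_irreducibles L) (join_irreducibles (congruence_lattice L))"
    using inj join_irreducibles_congruences by (simp add: bij_betw_def)
  have "finite (meet_irreducibles L)"
    using finite_carrier by (rule rev_finite_subset) (auto simp: meet_irreducibles_def)
  moreover have "card ((\<lambda>m. principal_congruence L m (upper_cover L m)) ` meet_irreducibles L) =
      card (meet_irreducibles L)"
    using bij_betw_same_card[OF j] card meet_irreducibles_congruences by simp
  ultimately have "bij_betw (\<lambda>m. principal_congruence L m (upper_cover L m))
      (meet_irreducibles L) (join_irreducibles (congruence_lattice L))"
    unfolding bij_betw_def using eq_card_imp_inj_on meet_irreducibles_congruences by blast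
  then show ?thesis using j by unfold_locales
qed

end

section \<open>Arcs spanning a longer path\<close>

context vertebrate_dag
begin

abbreviation L where "L \<equiv> acyclic_reorientations D"

lemma vwalk_arcs_sorted:
  "set (vwalk_arcs p) \<subseteq> A \<Longrightarrow> sorted_wrt (\<lambda>x y. (x, y) \<in> A\<^sup>+) p"
proof (induction p rule: vwalk_arcs.induct)
  case (3 x y xs)
  then have "sorted_wrt (\<lambda>x y. (x, y) \<in> A\<^sup>+) (y # xs)" "(x, y) \<in> A" by auto
  then show ?case by (auto intro: trancl_into_trancl2)
qed auto

lemma sorted_distinct: "sorted_wrt (\<lambda>x y. (x, y) \<in> A\<^sup>+) p \<Longrightarrow> distinct p"
  by (induction p) (auto simp: less_irrefl)

lemma vwalk_exists:
  assumes "(a, b) \<in> A\<^sup>*"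
  shows "\<exists>xs. set (vwalk_arcs (a # xs)) \<subseteq> A \<and> last (a # xs) = b"
  using assms
proof (induction rule: converse_rtrancl_induct)
  case base
  then show ?case by (intro exI[of _ "[]"]) simp
next
  case (step y z)
  then obtain xs where "set (vwalk_arcs (z # xs)) \<subseteq> A" "last (z # xs) = b" by blast
  then show ?case using step(1) by (intro exI[of _ "z # xs"]) simp
qed

lemma vwalk_arcs_append_tl:
  "vwalk_arcs (x # xs @ ys) = vwalk_arcs (x # xs) @ vwalk_arcs (last (x # xs) # ys)"
  by (induction xs arbitrary: x) auto

lemma vwalk_arcs_verts:
  "set (vwalk_arcs (x # xs)) \<subseteq> A \<Longrightarrow> xs \<noteq> [] \<Longrightarrow> set (x # xs) \<subseteq> pverts D"
proof (induction xs arbitrary: x)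
  case (Cons y ys)
  then show ?case using arcs_verts by (cases "ys = []") auto
qed simp

text \<open>Three vertices suffice: paths through \<open>w\<close> concatenate to a path, as
  acyclicity prevents repetitions, and conversely a long path is cut down from its two ends.\<close>

lemma filled_iff:
  "filled D \<longleftrightarrow> (\<forall>u v w. (u, v) \<in> A \<longrightarrow> (u, w) \<in> A\<^sup>+ \<longrightarrow> (w, v) \<in> A\<^sup>+ \<longrightarrow>
      (u, w) \<in> A \<and> (w, v) \<in> A)"
proof
  assume F: "filled D"
  show "\<forall>u v w. (u, v) \<in> A \<longrightarrow> (u, w) \<in> A\<^sup>+ \<longrightarrow> (w, v) \<in> A\<^sup>+ \<longrightarrow>
      (u, w) \<in> A \<and> (w, v) \<in> A"
  proof (intro allI impI)
    fix u v w assume uv: "(u, v) \<in> A" and uw: "(u, w) \<in> A\<^sup>+" and wv: "(w, v) \<in> A\<^sup>+"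
    obtain xs where xs: "set (vwalk_arcs (u # xs)) \<subseteq> A" "last (u # xs) = w"
      using vwalk_exists uw by (meson trancl_into_rtrancl)
    obtain ys where ys: "set (vwalk_arcs (w # ys)) \<subseteq> A" "last (w # ys) = v"
      using vwalk_exists wv by (meson trancl_into_rtrancl)
    have ne: "xs \<noteq> []" "ys \<noteq> []" using xs ys uw wv less_irrefl by auto
    let ?p = "u # xs @ ys"
    have arcs: "set (vwalk_arcs ?p) \<subseteq> A" using xs ys by (simp add: vwalk_arcs_append_tl)
    have "distinct ?p" using vwalk_arcs_sorted[OF arcs] by (rule sorted_distinct)
    then have p: "vpath ?p (with_proj D)"
      using arcs vwalk_arcs_verts[of u "xs @ ys"] ne by (auto simp: vpath_def vwalk_def)
    have lst: "last ?p = v" using ys ne by simp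
    then have nth: "?p ! (length xs + length ys) = v" using last_conv_nth[of ?p] by simp
    have nthw: "?p ! length xs = w"
      using nth_append[of "u # xs" ys "length xs"] last_conv_nth[of "u # xs"] xs by simp
    have H: "\<forall>i j. i < j \<longrightarrow> j < length ?p \<longrightarrow> (?p ! i, ?p ! j) \<in> A"
      using F p uv lst unfolding filled_def by (metis list.sel(1))
    have "(?p ! 0, ?p ! length xs) \<in> A" "(?p ! length xs, ?p ! (length xs + length ys)) \<in> A"
      by (intro H[rule_format]; use ne in auto)+
    then show "(u, w) \<in> A \<and> (w, v) \<in> A" unfolding nth nthw by simp
  qed
next
  assume T: "\<forall>u v w. (u, v) \<in> A \<longrightarrow> (u, w) \<in> A\<^sup>+ \<longrightarrow> (w, v) \<in> A\<^sup>+ \<longrightarrow>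
      (u, w) \<in> A \<and> (w, v) \<in> A"
  show "filled D"
    unfolding filled_def
  proof (intro allI impI)
    fix p i j
    assume p: "vpath p (with_proj D)" and a: "(hd p, last p) \<in> A" and ij: "i < j" "j < length p"
    have s: "sorted_wrt (\<lambda>x y. (x, y) \<in> A\<^sup>+) p"
      using p by (intro vwalk_arcs_sorted) (auto simp: vpath_def vwalk_def)
    have lt: "(p ! k, p ! l) \<in> A\<^sup>+" if "k < l" "l < length p" for k l
      using s that by (simp add: sorted_wrt_iff_nth_less)
    have "p \<noteq> []" using ij by auto
    then have ends: "hd p = p ! 0" "last p = p ! (length p - 1)"
      by (simp_all add: hd_conv_nth last_conv_nth)
    \<comment> \<open>Shorten at the far end first; the arc from the start to \<open>p ! j\<close>
      then allows shortening at the near end.\<close>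
    have uj: "(p ! 0, p ! j) \<in> A"
    proof (cases "j = length p - 1")
      case False
      then have "(p ! 0, p ! j) \<in> A\<^sup>+" "(p ! j, p ! (length p - 1)) \<in> A\<^sup>+"
        using ij by (auto intro!: lt)
      then show ?thesis using T a unfolding ends by blast
    qed (use a ends in simp)
    show "(p ! i, p ! j) \<in> A"
    proof (cases "i = 0")
      case False
      then have "(p ! 0, p ! i) \<in> A\<^sup>+" "(p ! i, p ! j) \<in> A\<^sup>+"
        using ij by (auto intro!: lt)
      then show ?thesis using T uj by blast
    qed (use uj in simp)
  qed
qed

lemma between_comparable:
  assumes "x \<in> between u v" "y \<in> between u v"
  shows "(x, y) \<in> A\<^sup>* \<or> (y, x) \<in> A\<^sup>*"
  using interval_chain[of u x UNIV v y] assms by (simp add: between_def)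

lemma le_iff: "(x, y) \<in> A\<^sup>* \<longleftrightarrow> x = y \<or> (x, y) \<in> A\<^sup>+"
  by (auto simp: rtrancl_eq_or_trancl)

definition cut :: "'a \<Rightarrow> 'a \<Rightarrow> 'a set \<Rightarrow> 'a rel" where
  "cut u v P = {(x, y) \<in> A. x \<in> between u v \<inter> P \<and> y \<in> between u v - P}"

text \<open>Arcs of a cut cannot be composed, as they start in \<open>P\<close> and end outside. A
  path with the same endpoints must leave \<open>P\<close> at some arc, and by convexity of the
  interval that arc is in the cut. The set \<open>P\<close> is arbitrary, which later covers
  ropes.\<close>

lemma cut_biclosed: "biclosed (cut u v P)"
proof -
  have c: "(x, y) \<in> cut u v P" if "(x, y) \<in> (cut u v P)\<^sup>+" for x y
    using that by (induction rule: trancl_induct) (auto simp: cut_def)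
  have False if path: "(x, y) \<in> (A - cut u v P)\<^sup>+" and mem: "(x, y) \<in> cut u v P" for x y
  proof -
    have xy: "x \<in> between u v" "x \<in> P" "y \<in> between u v" "y \<notin> P" using mem by (auto simp: cut_def)
    obtain a b where ab: "(a, b) \<in> A - cut u v P" "a \<in> P" "b \<notin> P"
      "(x, a) \<in> (A - cut u v P)\<^sup>*" "(b, y) \<in> (A - cut u v P)\<^sup>*"
      using rtrancl_exits[OF trancl_into_rtrancl[OF path] xy(2,4)] by blast
    have "(A - cut u v P)\<^sup>* \<subseteq> A\<^sup>*" by (rule rtrancl_mono) auto
    then have "(x, a) \<in> A\<^sup>*" "(b, y) \<in> A\<^sup>*" "(a, b) \<in> A" using ab by auto
    then have "(u, a) \<in> A\<^sup>*" "(u, b) \<in> A\<^sup>*" "(a, v) \<in> A\<^sup>*" "(b, v) \<in> A\<^sup>*"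
      using xy unfolding between_def
      by (auto intro: rtrancl_trans rtrancl_into_rtrancl converse_rtrancl_into_rtrancl)
    then show False using ab by (auto simp: cut_def between_def)
  qed
  moreover have "cut u v P \<subseteq> A" by (auto simp: cut_def)
  ultimately show ?thesis using c by (intro biclosedI) blast+
qed

lemma rel_join_absorb:
  assumes "biclosed S" "R \<subseteq> S"
  shows "rel_join R S = S" "rel_join S R = S"
proof -
  have "S \<subseteq> rel_join R S" "S \<subseteq> rel_join S R" using biclosedD(1)[OF assms(1)] by (auto simp: rel_join_def)
  then show "rel_join R S = S" "rel_join S R = S"
    using rel_join_least[OF assms order_refl] rel_join_least[OF assms(1) order_refl assms(2)] by blast+
qed

lemma rel_meet_absorb: "biclosed R \<Longrightarrow> biclosed S \<Longrightarrow> R \<subseteq> S \<Longrightarrow> rel_meet R S = R"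
  by (intro equalityI rel_meet_greatest rel_meet_lower) auto

end

locale shortcut = vertebrate_dag +
  fixes u v w :: 'a
  assumes uv: "(u, v) \<in> A" and uw: "(u, w) \<in> A\<^sup>+" and wv: "(w, v) \<in> A\<^sup>+"
begin

text \<open>The interval between u and v is a chain; S1 and S2 reverse the arcs of this chain that
  cross the cut just before, respectively just after, w.\<close>

definition S1 where "S1 = cut u v {x. (x, w) \<in> A\<^sup>+}"
definition S2 where "S2 = cut u v {x. (x, w) \<in> A\<^sup>*}"

lemma w_between: "w \<in> between u v"
  using uw wv by (simp add: between_def trancl_into_rtrancl)

lemma between_cases: "x \<in> between u v \<Longrightarrow> (x, w) \<in> A\<^sup>+ \<or> x = w \<or> (w, x) \<in> A\<^sup>+"
  using between_comparable[OF _ w_between] by (auto simp: le_iff)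

lemma mem_S1: "(x, y) \<in> S1 \<longleftrightarrow>
    (x, y) \<in> A \<and> (u, x) \<in> A\<^sup>* \<and> (x, w) \<in> A\<^sup>+ \<and> (w, y) \<in> A\<^sup>* \<and> (y, v) \<in> A\<^sup>*"
  (is "_ \<longleftrightarrow> ?R")
proof
  show ?R if "(x, y) \<in> S1" using that between_cases[of y] by (auto simp: S1_def cut_def between_def le_iff)
  show "(x, y) \<in> S1" if r: ?R
  proof -
    have "(y, w) \<notin> A\<^sup>+" using r less_not_le by blast
    moreover have "(x, v) \<in> A\<^sup>*" "(u, y) \<in> A\<^sup>*"
      using r by (meson rtrancl.rtrancl_into_rtrancl converse_rtrancl_into_rtrancl)+
    ultimately show ?thesis using r by (auto simp: S1_def cut_def between_def)
  qed
qed

lemma mem_S2: "(x, y) \<in> S2 \<longleftrightarrow>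
    (x, y) \<in> A \<and> (u, x) \<in> A\<^sup>* \<and> (x, w) \<in> A\<^sup>* \<and> (w, y) \<in> A\<^sup>+ \<and> (y, v) \<in> A\<^sup>*"
  (is "_ \<longleftrightarrow> ?R")
proof
  show ?R if "(x, y) \<in> S2" using that between_cases[of y] by (auto simp: S2_def cut_def between_def le_iff)
  show "(x, y) \<in> S2" if r: ?R
  proof -
    have "(y, w) \<notin> A\<^sup>*" using r less_not_le by blast
    moreover have "(x, v) \<in> A\<^sup>*" "(u, y) \<in> A\<^sup>*"
      using r by (meson rtrancl.rtrancl_into_rtrancl converse_rtrancl_into_rtrancl)+
    ultimately show ?thesis using r by (auto simp: S2_def cut_def between_def)
  qed
qed

lemma biclosed_S: "biclosed S1" "biclosed S2"
  by (simp_all add: S1_def S2_def cut_biclosed)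

lemma uv_mem: "(u, v) \<in> S1" "(u, v) \<in> S2"
  using uv uw wv by (auto simp: mem_S1 mem_S2 trancl_into_rtrancl)

text \<open>An arc common to both cuts passes strictly over \<open>w\<close>. A path through
  \<open>w\<close> with the same endpoints consists of arcs that do not, so it runs in
  \<open>A - Y\<close>, against biclosedness.\<close>

lemma S_disjoint:
  assumes Y: "biclosed Y" and sub: "Y \<subseteq> S1" "Y \<subseteq> S2"
  shows "Y = {}"
proof (rule ccontr)
  assume "Y \<noteq> {}"
  then obtain x y where xy: "(x, y) \<in> Y" by auto
  then have xw: "(x, w) \<in> A\<^sup>+" and wy: "(w, y) \<in> A\<^sup>+" using sub by (auto simp: mem_S1 mem_S2)
  have Y1: "(a, w) \<in> A\<^sup>+" and Y2: "(w, b) \<in> A\<^sup>+" if "(a, b) \<in> Y" for a b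
    using that sub by (auto simp: mem_S1 mem_S2)
  have "(a, w) \<in> (A - Y)\<^sup>+" if "(a, w) \<in> A\<^sup>+" for a
    using that
  proof (induction rule: converse_trancl_induct)
    case (base a)
    then show ?case using Y2 less_irrefl by blast
  next
    case (step a b)
    then have "(a, b) \<notin> Y" using Y2[of a b] less_not_le trancl_into_rtrancl by metis
    then show ?case using step by (auto intro: trancl_into_trancl2)
  qed
  then have "(x, w) \<in> (A - Y)\<^sup>+" using xw by blast
  moreover have "(w, b) \<in> (A - Y)\<^sup>+" if "(w, b) \<in> A\<^sup>+" for b
    using that
  proof (induction rule: trancl_induct)
    case (base b)
    then show ?case using Y1 less_irrefl by blast
  next
    case (step a b)
    then have "(a, b) \<notin> Y" using Y1[of a b] less_not_le trancl_into_rtrancl by metis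
    then show ?case using step by (auto intro: trancl_into_trancl)
  qed
  then have "(w, y) \<in> (A - Y)\<^sup>+" using wy by blast
  ultimately have "(x, y) \<in> (A - Y)\<^sup>+" by (rule trancl_trans)
  then show False using xy biclosedD(2)[OF Y] by blast
qed

lemma rel_meet_S: "rel_meet S1 S2 = {}"
  by (intro S_disjoint rel_meet_biclosed rel_meet_lower biclosed_S)

definition Z where "Z = S1 \<union> S2"

lemma mem_Z: "(x, y) \<in> Z \<longleftrightarrow>
    (x, y) \<in> A \<and> (u, x) \<in> A\<^sup>* \<and> (x, w) \<in> A\<^sup>* \<and> (w, y) \<in> A\<^sup>* \<and> (y, v) \<in> A\<^sup>*"
  using less_irrefl by (auto simp: Z_def mem_S1 mem_S2 le_iff)

lemma trancl_Z:
  assumes "(x, y) \<in> Z\<^sup>+"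
  shows "(u, x) \<in> A\<^sup>* \<and> (x, w) \<in> A\<^sup>* \<and> (w, y) \<in> A\<^sup>* \<and> (y, v) \<in> A\<^sup>*"
  using assms by (induction rule: trancl_induct) (auto simp: mem_Z)

lemma rel_join_S: "rel_join S1 S2 = Z"
proof -
  have "(x, y) \<in> Z\<^sup>+ \<inter> A \<longleftrightarrow> (x, y) \<in> Z" for x y
    using trancl_Z[of x y] mem_Z[of x y] by blast
  then show ?thesis by (auto simp: rel_join_def Z_def)
qed

lemma biclosed_Z: "biclosed Z"
  using rel_join_biclosed biclosed_S rel_join_S by metis

text \<open>The failing triple is \<open>X\<close>, \<open>S1\<close>, \<open>S2\<close>: one side
  of the law is \<open>X\<close> since the meet of the cuts is empty, the other is
  \<open>S1\<close>, and \<open>(u, v)\<close> tells them apart.\<close>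

lemma not_distributive: "\<not> distributive_lattice L"
proof
  assume "distributive_lattice L"
  then interpret dl: distributive_lattice L .
  \<comment> \<open>The arcs into \<open>w\<close> from above \<open>u\<close>. An arc of
    \<open>S1\<close> ends at \<open>w\<close>, hence is in \<open>X\<close>, or beyond
    \<open>w\<close>, hence is in \<open>S2\<close>; so the join of \<open>X\<close> with
    \<open>S2\<close> is already \<open>Z\<close>.\<close>
  define X where "X = {(x, y) \<in> A. (u, x) \<in> A\<^sup>* \<and> y = w}"
  have XX: "(x, y) \<in> X" if "(x, y) \<in> X\<^sup>+" for x y
    using that by (induction rule: trancl_induct) (use less_irrefl in \<open>auto simp: X_def\<close>)
  have "(x, y) \<notin> X" if path: "(x, y) \<in> (A - X)\<^sup>+" for x y
  proof
    assume xy: "(x, y) \<in> X"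
    obtain z where z: "(x, z) \<in> (A - X)\<^sup>*" "(z, y) \<in> A - X" using path by (meson tranclD2)
    have "(x, z) \<in> A\<^sup>*" using z(1) rtrancl_mono[of "A - X" A] by auto
    moreover have "(u, x) \<in> A\<^sup>*" using xy by (simp add: X_def)
    ultimately have "(u, z) \<in> A\<^sup>*" by (rule rtrancl_trans[rotated])
    then show False using z(2) xy by (auto simp: X_def)
  qed
  moreover have "X \<subseteq> A" by (auto simp: X_def)
  ultimately have X: "biclosed X" using XX by (intro biclosedI) blast+
  have XS: "X \<subseteq> S1" using wv by (auto simp: X_def mem_S1 trancl_into_rtrancl)
  have Z: "rel_join X S2 = Z"
  proof
    show "rel_join X S2 \<subseteq> Z" by (rule rel_join_least[OF biclosed_Z]) (use XS in \<open>auto simp: Z_def\<close>)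
    have "S1 \<subseteq> X \<union> S2" by (auto simp: X_def mem_S1 mem_S2 le_iff)
    then show "Z \<subseteq> rel_join X S2" using rel_join_upper[OF X biclosed_S(2)] by (auto simp: Z_def)
  qed
  have "rel_join X (rel_meet S1 S2) = rel_meet (rel_join X S1) (rel_join X S2)"
    using dl.join_distrib[of X S1 S2] X biclosed_S
    by (simp add: AR_simps AR_join AR_meet rel_meet_biclosed rel_join_biclosed)
  moreover have "rel_join X (rel_meet S1 S2) = X" using X by (simp add: rel_meet_S rel_join_absorb)
  moreover have "rel_meet (rel_join X S1) (rel_join X S2) = S1"
    using biclosed_S biclosed_Z XS Z by (simp add: rel_join_absorb) (simp add: rel_meet_absorb Z_def)
  ultimately have "(u, v) \<in> X" using uv_mem by simp
  then show False using wv less_irrefl by (auto simp: X_def)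
qed

end

locale unfilled = shortcut +
  assumes unfilled: "\<not> ((u, w) \<in> A \<and> (w, v) \<in> A)"
begin

text \<open>Removing \<open>(u, v)\<close> can only create a conflict at the pair
  \<open>(u, v)\<close> itself. Arcs of \<open>Z\<close> start at or before \<open>w\<close> and end
  at or after it, so another path in \<open>Z\<close> from \<open>u\<close> to \<open>v\<close>
  could only be \<open>u\<close>, \<open>w\<close>, \<open>v\<close>, which \<open>unfilled\<close>
  excludes.\<close>

lemma biclosed_Z_minus: "biclosed (Z - {(u, v)})"
proof -
  let ?R = "Z - {(u, v)}"
  have False if xy: "(x, y) \<in> ?R\<^sup>+" "(x, y) \<in> (A - ?R)\<^sup>+" for x y
  proof -
    have xyZ: "(x, y) \<in> Z\<^sup>+" using xy(1) by (rule trancl_mono) auto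
    have ne: "x \<noteq> y"
    proof
      assume "x = y"
      moreover have "(x, y) \<in> A\<^sup>+" using xyZ by (rule trancl_mono) (auto simp: mem_Z)
      ultimately show False using less_irrefl by simp
    qed
    have "(x, y) \<notin> (A - Z)\<^sup>+" using xyZ biclosedD(2)[OF biclosed_Z] by blast
    then have "(x, y) \<notin> (A - Z)\<^sup>*" using ne by (meson rtranclD)
    from rtrancl_leaves[OF trancl_into_rtrancl[OF xy(2)] this]
    have uvp: "(x, u) \<in> (A - ?R)\<^sup>*" "(v, y) \<in> (A - ?R)\<^sup>*" by auto
    have "(A - ?R)\<^sup>* \<subseteq> A\<^sup>*" by (rule rtrancl_mono) auto
    then have "(x, u) \<in> A\<^sup>*" "(v, y) \<in> A\<^sup>*" using uvp by auto
    then have "x = u" "y = v" using trancl_Z[OF xyZ] le_antisym by blast+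
    then have "(u, v) \<in> ?R\<^sup>+" using xy by simp
    then obtain z where z: "(u, z) \<in> ?R" "(z, v) \<in> ?R\<^sup>*" by (meson tranclD)
    then have "z \<noteq> v" by auto
    then obtain z' where z': "(z, z') \<in> ?R" "(z', v) \<in> ?R\<^sup>*" using z by (meson converse_rtranclE)
    have "z = w" using z z' le_antisym by (auto simp: mem_Z)
    have "z' = v"
    proof (rule ccontr)
      assume "z' \<noteq> v"
      then obtain z'' where "(z', z'') \<in> ?R" using z' by (meson converse_rtranclE)
      then have "z' = w" using z' le_antisym by (auto simp: mem_Z)
      then show False using z'(1) \<open>z = w\<close> less_irrefl by (auto simp: mem_Z)
    qed
    then show False using z(1) z'(1) \<open>z = w\<close> unfilled by (auto simp: mem_Z)
  qed
  moreover have "?R \<subseteq> A" by (auto simp: mem_Z)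
  ultimately show ?thesis by (intro biclosedI) blast+
qed

text \<open>Either cut restores the missing arc \<open>(u, v)\<close>, so both joins with
  \<open>Z - {(u, v)}\<close> are \<open>Z\<close>, whereas the meet of the cuts is empty.\<close>

lemma not_join_semidistributive: "\<not> join_semidistributive_lattice L"
proof
  assume "join_semidistributive_lattice L"
  then interpret sd: join_semidistributive_lattice L .
  let ?R = "Z - {(u, v)}"
  note R = biclosed_Z_minus
  have J: "rel_join ?R S = Z" if "biclosed S" "(u, v) \<in> S" "S \<subseteq> Z" for S
    using that rel_join_least[OF biclosed_Z, of ?R S] rel_join_upper[OF R that(1)] by auto
  have "rel_join ?R S1 = Z" "rel_join ?R S2 = Z" using J biclosed_S uv_mem by (auto simp: Z_def)
  then have "rel_join ?R (rel_meet S1 S2) = Z"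
    using sd.join_semidistrib[of ?R S1 S2] R biclosed_S by (simp add: AR_simps AR_join AR_meet rel_meet_biclosed)
  then have "?R = Z" using R by (simp add: rel_meet_S rel_join_absorb)
  then show False using uv_mem by (auto simp: Z_def)
qed

text \<open>Below S1 and S2 there are distinct join irreducibles, both perspective to the
  cover relation that adds (u,v) to Z - (u,v).\<close>

lemma not_congruence_uniform: "\<not> congruence_uniform_lattice L"
proof
  assume "congruence_uniform_lattice L"
  then interpret cu: congruence_uniform_lattice L .
  let ?R = "Z - {(u, v)}"
  let ?pc = "\<lambda>j. principal_congruence L (lower_cover L j) j"
  note R = biclosed_Z_minus
  have ex: "\<exists>j \<in> join_irreducibles L. j \<subseteq> S \<and> j \<noteq> {} \<and> ?pc j = principal_congruence L ?R Z"
    if S: "biclosed S" "(u, v) \<in> S" "S \<subseteq> Z" for S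
  proof -
    \<comment> \<open>By minimality, everything strictly below \<open>j\<close> misses
      \<open>(u, v)\<close> and so lies in \<open>?R\<close>: the meet of \<open>j\<close> with
      \<open>?R\<close> is the unique lower cover of \<open>j\<close>.\<close>
    obtain j where j: "biclosed j" "(u, v) \<in> j" "j \<subseteq> S" and min: "\<And>i. biclosed i \<Longrightarrow> i \<subset> j \<Longrightarrow> (u, v) \<notin> i"
      using AR.minimal_element[of S "\<lambda>j. (u, v) \<in> j"] S
      by (auto simp: AR.lless_iff psubset_eq)
    have rel_join: "rel_join j ?R = Z"
      using j S rel_join_least[OF biclosed_Z, of j ?R] rel_join_upper[OF j(1) R] by auto
    have le: "i \<subseteq> rel_meet j ?R" if "biclosed i" "i \<subset> j" for i
      by (rule rel_meet_greatest) (use that min[of i] j S in auto)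
    have m: "biclosed (rel_meet j ?R)" "rel_meet j ?R \<subset> j"
      using rel_meet_biclosed[OF j(1) R] rel_meet_lower[OF j(1) R] j by auto
    have ji: "j \<in> join_irreducibles L" "lower_cover L j = rel_meet j ?R"
      using AR.join_irreducibleI[of "rel_meet j ?R" j] m j le by (auto simp: AR.lless_iff psubset_eq)
    have "?pc j = principal_congruence L ?R Z"
      using AR.principal_congruence_perspective[of j ?R] j R rel_join
      by (simp add: ji AR_join AR_meet)
    then show ?thesis using ji j by blast
  qed
  obtain j1 where j1: "j1 \<in> join_irreducibles L" "j1 \<subseteq> S1" "j1 \<noteq> {}"
    "?pc j1 = principal_congruence L ?R Z"
    using ex[OF biclosed_S(1) uv_mem(1)] by (auto simp: Z_def)
  obtain j2 where j2: "j2 \<in> join_irreducibles L" "j2 \<subseteq> S2" "j2 \<noteq> {}"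
    "?pc j2 = principal_congruence L ?R Z"
    using ex[OF biclosed_S(2) uv_mem(2)] by (auto simp: Z_def)
  have "j1 = j2"
    using inj_onD[OF bij_betw_imp_inj_on[OF cu.join_irreducibles_bij], of j1 j2] j1(1,4) j2(1,4)
    by simp
  then show False using S_disjoint[of j1] j1 j2 by (auto simp: join_irreducibles_def AR_simps)
qed

end

section \<open>Distributivity and semidistributivity\<close>

context vertebrate_dag
begin

text \<open>Every subset of arcs of a forest is biclosed, so the lattice is Boolean.\<close>

lemma forest_distributive:
  assumes "forest_digraph D"
  shows "distributive_lattice L"
proof -
  have "bridged A" using forest_digraph_bridged[OF assms arcs_verts acyclic_arcs] .
  then have biclosed: "biclosed R \<longleftrightarrow> R \<subseteq> A" for R
    using bridged_reorient_acyclic biclosed_iff_acyclic biclosedD(1) by metis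
  have j: "rel_join R S = R \<union> S" and m: "rel_meet R S = R \<inter> S" if "R \<subseteq> A" "S \<subseteq> A" for R S
  proof -
    show "rel_join R S = R \<union> S"
      using that by (intro equalityI rel_join_least Un_least rel_join_upper) (auto simp: biclosed)
    show "rel_meet R S = R \<inter> S"
      using that by (intro equalityI rel_meet_greatest Int_greatest rel_meet_lower) (auto simp: biclosed)
  qed
  show ?thesis
  proof (unfold_locales, unfold AR_simps mem_Collect_eq)
    fix x y z assume b: "biclosed x" "biclosed y" "biclosed z"
    then have sub: "x \<subseteq> A" "y \<subseteq> A" "z \<subseteq> A" by (simp_all add: biclosedD(1))
    have c: "x \<union> y \<subseteq> A" "x \<union> z \<subseteq> A" "y \<inter> z \<subseteq> A" using sub by auto
    show "x \<squnion>\<^bsub>L\<^esub> (y \<sqinter>\<^bsub>L\<^esub> z) = (x \<squnion>\<^bsub>L\<^esub> y) \<sqinter>\<^bsub>L\<^esub> (x \<squnion>\<^bsub>L\<^esub> z)"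
      using b c sub by (simp add: AR_join AR_meet j m biclosed Un_Int_distrib)
  qed
qed

lemma not_forest_shortcut:
  assumes "\<not> forest_digraph D"
  obtains u v w where "(u, v) \<in> A" "(u, w) \<in> A\<^sup>+" "(w, v) \<in> A\<^sup>+"
proof -
  interpret D: pair_digraph D by (rule digraph)
  have "induced_subgraph (with_proj D) (with_proj D)"
    using D.induced_subgraph_refl by simp
  then have "forest_digraph (transitive_reduction D)" using vertebrate by (simp add: vertebrate_def)
  then have "transitive_reduction D \<noteq> D" using assms by auto
  then have "parcs (transitive_reduction D) \<noteq> A" by (auto simp: transitive_reduction_def)
  then obtain u v p where "(u, v) \<in> A" "vpath p (with_proj D)" "hd p = u" "last p = v"
    "2 \<le> vwalk_length p"
    by (auto simp: transitive_reduction_def)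
  then show thesis using that vpath_inner by (metis r_into_trancl)
qed

lemma distributive_iff: "distributive_lattice L \<longleftrightarrow> forest_digraph D"
proof
  assume d: "distributive_lattice L"
  show "forest_digraph D"
  proof (rule ccontr)
    assume "\<not> forest_digraph D"
    then obtain u v w where t: "(u, v) \<in> A" "(u, w) \<in> A\<^sup>+" "(w, v) \<in> A\<^sup>+"
      by (rule not_forest_shortcut)
    interpret shortcut D u v w by unfold_locales (fact t)+
    show False using d not_distributive by simp
  qed
qed (rule forest_distributive)

lemma not_filled_unfilled:
  assumes "\<not> filled D"
  obtains u v w where "unfilled D u v w"
proof -
  obtain u v w where t: "(u, v) \<in> A" "(u, w) \<in> A\<^sup>+" "(w, v) \<in> A\<^sup>+"
    "\<not> ((u, w) \<in> A \<and> (w, v) \<in> A)"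
    using assms unfolding filled_iff by blast
  have "unfilled D u v w" by unfold_locales (use t in auto)
  then show thesis by (rule that)
qed

end

section \<open>Semidistributivity in the filled case\<close>

locale filled_dag = vertebrate_dag +
  assumes filled: "filled D"
begin

lemma filled_arcs:
  assumes "(u, v) \<in> A" "(u, w) \<in> A\<^sup>+" "(w, v) \<in> A\<^sup>+"
  shows "(u, w) \<in> A" "(w, v) \<in> A"
  using filled assms unfolding filled_iff by blast+

text \<open>If the law fails, some arc \<open>a\<close> is removable from \<open>Z\<close> and
  outside the left-hand side. It lies in \<open>S\<close> and in \<open>T\<close>, as otherwise one
  of the joins would fit into \<open>Z - {a}\<close>. Being outside the meet, it is spanned by a
  path whose arcs each miss \<open>S\<close> or \<open>T\<close>; following this path leads to a
  contradiction at its last arc.\<close>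

lemma rel_join_semidistrib:
  assumes R: "biclosed R" and S: "biclosed S" and T: "biclosed T" and eq: "rel_join R S = rel_join R T"
  shows "rel_join R (rel_meet S T) = rel_join R S"
proof (rule ccontr)
  assume ne: "rel_join R (rel_meet S T) \<noteq> rel_join R S"
  define Z where "Z = rel_join R S"
  have Z: "biclosed Z" "R \<subseteq> Z" "S \<subseteq> Z" "T \<subseteq> Z"
    using rel_join_biclosed[OF R S] rel_join_upper[OF R S] rel_join_upper[OF R T] eq by (simp_all add: Z_def)
  have W: "biclosed (rel_join R (rel_meet S T))" using R S T by (simp add: rel_join_biclosed rel_meet_biclosed)
  have "rel_join R (rel_meet S T) \<subseteq> Z" by (rule rel_join_least) (use Z rel_meet_lower[OF S T] in auto)
  then have "rel_join R (rel_meet S T) \<subset> Z" using ne unfolding Z_def by blast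
  then obtain a where a: "a \<in> Z" "a \<notin> rel_join R (rel_meet S T)" and Za: "biclosed (Z - {a})"
    using biclosed_remove[OF W Z(1)] by blast
  have aR: "a \<notin> R" and aST: "a \<notin> rel_meet S T" using a rel_join_upper[OF R rel_meet_biclosed[OF S T]] by auto
  have aS: "a \<in> S"
  proof (rule ccontr)
    assume "a \<notin> S"
    then have "rel_join R S \<subseteq> Z - {a}" by (intro rel_join_least[OF Za]) (use Z aR in auto)
    then show False using a by (auto simp: Z_def)
  qed
  have aT: "a \<in> T"
  proof (rule ccontr)
    assume "a \<notin> T"
    then have "rel_join R T \<subseteq> Z - {a}" by (intro rel_join_least[OF Za]) (use Z aR in auto)
    then show False using a eq by (auto simp: Z_def)
  qed
  obtain u v where uv: "a = (u, v)" by fastforce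
  have A: "(u, v) \<in> A" using aS biclosedD(1)[OF S] uv by auto
  define G where "G = (A - S) \<union> (A - T)"
  have G: "(u, v) \<in> G\<^sup>+" using aST A by (auto simp: rel_meet_def rel_join_def G_def uv)
  have GA: "(x, y) \<in> A\<^sup>+" if "(x, y) \<in> G\<^sup>+" for x y
    using that by (rule trancl_mono) (auto simp: G_def)
  \<comment> \<open>Two arcs of \<open>Z\<close> composing to \<open>a\<close> would put
    \<open>a\<close> back into the biclosed set \<open>Z - {a}\<close>.\<close>
  have tri: "(u, w) \<notin> Z \<or> (w, v) \<notin> Z" if "(u, w) \<in> A\<^sup>+" "(w, v) \<in> A\<^sup>+" for w
  proof (rule ccontr)
    assume "\<not> ?thesis"
    then have "(u, w) \<in> Z - {a}" "(w, v) \<in> Z - {a}" using that less_irrefl uv by auto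
    then have "(u, v) \<in> (Z - {a})\<^sup>+" by (meson r_into_trancl trancl_into_trancl)
    then show False using biclosed_closed[OF Za _ A] uv by blast
  qed
  have left: "(u, w) \<in> S \<inter> T" if "(u, w) \<in> A\<^sup>+" "(w, v) \<in> A\<^sup>+" "(w, v) \<notin> Z" for w
    using biclosed_triangle[OF S filled_arcs[OF A that(1,2)]]
      biclosed_triangle[OF T filled_arcs[OF A that(1,2)]] aS aT uv that(3) Z by auto
  have right: "(w, v) \<in> S \<inter> T" if "(u, w) \<in> A\<^sup>+" "(w, v) \<in> A\<^sup>+" "(u, w) \<notin> Z" for w
    using biclosed_triangle[OF S filled_arcs[OF A that(1,2)]]
      biclosed_triangle[OF T filled_arcs[OF A that(1,2)]] aS aT uv that(3) Z by auto
  \<comment> \<open>If \<open>(u, z)\<close> were in \<open>Z\<close>, then \<open>(z, v)\<close>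
    would not be, so \<open>(u, z)\<close> would be in both \<open>S\<close> and \<open>T\<close>;
    as \<open>(u, y)\<close> is in neither, the triangle puts \<open>(y, z)\<close> in both, against
    the choice of the path.\<close>
  have nZ: "(u, y) \<notin> Z" if "(u, y) \<in> G\<^sup>+" "(y, v) \<in> A\<^sup>+" for y
    using that
  proof (induction rule: trancl_induct)
    case (base y)
    then show ?case using tri[of y] left[of y] GA[of u y] by (auto simp: G_def)
  next
    case (step y z)
    have yz: "(y, z) \<in> A" "(y, z) \<notin> S \<inter> T" using step(2) by (auto simp: G_def)
    then have yv: "(y, v) \<in> A\<^sup>+" using step(4) by (meson trancl_into_trancl2)
    have uy: "(u, y) \<in> A\<^sup>+" and uz: "(u, z) \<in> A\<^sup>+"
      using GA step(1) yz(1) by (auto intro: trancl_into_trancl)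
    have n: "(u, y) \<notin> S" "(u, y) \<notin> T" using step(3)[OF yv] Z by auto
    show ?case
    proof
      assume "(u, z) \<in> Z"
      then have "(u, z) \<in> S \<inter> T" using tri[OF uz step(4)] left[OF uz step(4)] by blast
      then show False
        using biclosed_triangle[OF S filled_arcs(1)[OF A uy yv] yz(1)]
          biclosed_triangle[OF T filled_arcs(1)[OF A uy yv] yz(1)] n yz(2) by blast
    qed
  qed
  from G show False
  proof (cases rule: tranclE)
    case base
    then show False using aS aT uv by (auto simp: G_def)
  next
    case (step y)
    then have "(y, v) \<in> A\<^sup>+" by (auto simp: G_def)
    then have "(y, v) \<in> S \<inter> T" using right[of y] GA nZ[of y] step by blast
    then show False using step(2) by (auto simp: G_def)
  qed
qed

lemma semidistributive: "semidistributive_lattice L"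
proof (unfold_locales, unfold AR_simps mem_Collect_eq)
  fix x y z assume b: "biclosed x" "biclosed y" "biclosed z"
  show "x \<squnion>\<^bsub>L\<^esub> (y \<sqinter>\<^bsub>L\<^esub> z) = x \<squnion>\<^bsub>L\<^esub> y" if "x \<squnion>\<^bsub>L\<^esub> y = x \<squnion>\<^bsub>L\<^esub> z"
    using that b by (simp add: AR_join AR_meet rel_join_semidistrib rel_meet_biclosed)
  show "x \<sqinter>\<^bsub>L\<^esub> (y \<squnion>\<^bsub>L\<^esub> z) = x \<sqinter>\<^bsub>L\<^esub> y" if "x \<sqinter>\<^bsub>L\<^esub> y = x \<sqinter>\<^bsub>L\<^esub> z"
  proof -
    have "rel_meet x y = rel_meet x z" using that b by (simp add: AR_meet)
    then have "rel_join (A - x) (A - y) = rel_join (A - x) (A - z)"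
      by (auto simp: rel_meet_def rel_join_def)
    then have "rel_join (A - x) (rel_meet (A - y) (A - z)) = rel_join (A - x) (A - y)"
      using b by (simp add: rel_join_semidistrib biclosed_compl)
    moreover have "rel_meet (A - y) (A - z) = A - rel_join y z"
      using b biclosedD(1) by (simp add: rel_meet_def double_diff)
    ultimately have "rel_meet x (rel_join y z) = rel_meet x y" by (simp add: rel_meet_def)
    then show ?thesis using b by (simp add: AR_join AR_meet rel_join_biclosed)
  qed
qed

end

context vertebrate_dag
begin

lemma semidistributive_iff: "semidistributive_lattice L \<longleftrightarrow> filled D"
proof
  assume s: "semidistributive_lattice L"
  show "filled D"
  proof (rule ccontr)
    assume "\<not> filled D"
    then obtain u v w where "unfilled D u v w" by (rule not_filled_unfilled)
    then interpret unfilled D u v w .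
    show False using not_join_semidistributive s by (simp add: semidistributive_lattice_def)
  qed
next
  assume "filled D"
  then interpret filled_dag D by unfold_locales
  show "semidistributive_lattice L" by (rule semidistributive)
qed

end

section \<open>Congruence normality\<close>

context vertebrate_dag
begin

text \<open>It suffices that \<open>f\<close> of a join or meet depends only on the values of
  \<open>f\<close> at its arguments; no order on the image has to be specified.\<close>

lemma kernel_congruence:
  assumes "\<And>R R' S S'. \<lbrakk>biclosed R; biclosed R'; biclosed S; biclosed S'; f R = f R'; f S = f S'\<rbrakk> \<Longrightarrow>
      f (rel_join R S) = f (rel_join R' S') \<and> f (rel_meet R S) = f (rel_meet R' S')"
  shows "lattice_congruence L {(R, S). biclosed R \<and> biclosed S \<and> f R = f S}"
  using assms unfolding lattice_congruence_def equiv_def refl_on_def sym_def trans_def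
  by (auto simp: AR_simps AR_join AR_meet rel_join_biclosed rel_meet_biclosed)

text \<open>Intervals are convex, hence restriction to them is a lattice homomorphism.\<close>

lemma trancl_Restr_interval:
  assumes "B \<subseteq> A" "(x, y) \<in> B\<^sup>+" "x \<in> between u v" "y \<in> between u v"
  shows "(x, y) \<in> (Restr B (between u v))\<^sup>+"
  using assms(2,4)
proof (induction rule: trancl_induct)
  case (base y)
  then show ?case using assms(3) by auto
next
  case (step y z)
  have "(x, y) \<in> A\<^sup>+" using step(1) assms(1) by (rule trancl_mono)
  then have "(u, y) \<in> A\<^sup>*" using assms(3) unfolding between_def
    by (auto intro: rtrancl_trans trancl_into_rtrancl)
  moreover have "(y, v) \<in> A\<^sup>*" using step(2,4) assms(1) unfolding between_def
    by (auto intro: converse_rtrancl_into_rtrancl)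
  ultimately have "y \<in> between u v" by (simp add: between_def)
  then show ?case using step by (auto intro: trancl_into_trancl)
qed

lemma interval_congruence:
  "lattice_congruence L {(R, S). biclosed R \<and> biclosed S \<and> Restr R (between u v) = Restr S (between u v)}"
proof (rule kernel_congruence)
  let ?I = "between u v"
  have j: "Restr (rel_join R S) ?I = Restr ((Restr R ?I \<union> Restr S ?I)\<^sup>+ \<inter> A) ?I"
    if sub: "R \<subseteq> A" "S \<subseteq> A" for R S
  proof -
    have "(x, y) \<in> (Restr R ?I \<union> Restr S ?I)\<^sup>+"
      if "(x, y) \<in> (R \<union> S)\<^sup>+" "x \<in> ?I" "y \<in> ?I" for x y
    proof -
      have "Restr (R \<union> S) ?I = Restr R ?I \<union> Restr S ?I" by auto
      then show ?thesis using trancl_Restr_interval[of "R \<union> S" x y u v] sub that by auto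
    qed
    moreover have "(Restr R ?I \<union> Restr S ?I)\<^sup>+ \<subseteq> (R \<union> S)\<^sup>+"
      using trancl_mono[of _ "Restr R ?I \<union> Restr S ?I" "R \<union> S"] by blast
    ultimately show ?thesis by (auto simp: rel_join_def)
  qed
  fix R R' S S'
  assume b: "biclosed R" "biclosed R'" "biclosed S" "biclosed S'"
    and eq: "Restr R ?I = Restr R' ?I" "Restr S ?I = Restr S' ?I"
  have c: "Restr (A - X) ?I = Restr A ?I - Restr X ?I" for X by auto
  show "Restr (rel_join R S) ?I = Restr (rel_join R' S') ?I \<and> Restr (rel_meet R S) ?I = Restr (rel_meet R' S') ?I"
    using b biclosedD(1) eq by (simp add: j rel_meet_def c del: Int_Diff)
qed

lemma Restr_insert_eq: "a \<notin> X \<Longrightarrow> Restr X I = Restr (insert a X) I \<longleftrightarrow> a \<notin> I \<times> I"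
  by (cases "a \<in> I \<times> I") auto

lemma meet_irreducible_covers:
  assumes "m \<in> meet_irreducibles L"
  shows "covers L (upper_cover L m) m"
proof -
  have "\<exists>!n. covers L n m" using assms unfolding meet_irreducibles_def by blast
  then show ?thesis unfolding upper_cover_def by (rule theI')
qed

text \<open>Restriction to an interval collapses a cover relation exactly if the reversed arc is not
  inside. Testing the intervals spanned by \<open>a\<close> and by \<open>b\<close> gives
  \<open>a = b\<close>, but \<open>a\<close> belongs to \<open>j\<close>, hence to \<open>m\<close>,
  while \<open>b\<close> does not belong to \<open>m\<close>.\<close>

lemma congruence_normal: "congruence_normal_lattice L"
proof (unfold_locales, unfold AR_simps)
  fix j m assume j: "j \<in> join_irreducibles L" and m: "m \<in> meet_irreducibles L" and jm: "j \<subseteq> m"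
  obtain a where a: "a \<notin> lower_cover L j" "j = insert a (lower_cover L j)"
    "biclosed (lower_cover L j)" "biclosed j"
    using covers_insert[OF AR.join_irreducibleD(1)[OF j]] by metis
  obtain b where b: "b \<notin> m" "upper_cover L m = insert b m" "biclosed m" "biclosed (upper_cover L m)"
    using covers_insert[OF meet_irreducible_covers[OF m]] by metis
  show "principal_congruence L (lower_cover L j) j \<noteq> principal_congruence L m (upper_cover L m)"
  proof
    assume eq: "principal_congruence L (lower_cover L j) j = principal_congruence L m (upper_cover L m)"
    have same: "a \<in> I \<times> I \<longleftrightarrow> b \<in> I \<times> I" if I: "I = between u v" for I u v
    proof -
      have "Restr (lower_cover L j) I = Restr j I \<longleftrightarrow> Restr m I = Restr (upper_cover L m) I"
        using eq[unfolded AR.principal_congruence_eq_iff[simplified, OF a(3,4) b(3,4)], rule_format,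
            OF interval_congruence[of u v]] a b I by simp
      moreover have "Restr (lower_cover L j) I = Restr j I \<longleftrightarrow> a \<notin> I \<times> I"
        by (rule Restr_insert_eq[OF a(1), of I, folded a(2)])
      moreover have "Restr m I = Restr (upper_cover L m) I \<longleftrightarrow> b \<notin> I \<times> I"
        unfolding b(2) by (rule Restr_insert_eq[OF b(1)])
      ultimately show ?thesis by blast
    qed
    obtain u v u' v' where uv: "a = (u, v)" "b = (u', v')" by fastforce
    have arcs: "(u, v) \<in> A" "(u', v') \<in> A"
      using a b uv biclosedD(1)[of j] biclosedD(1)[of "upper_cover L m"] by auto
    have "b \<in> between u v \<times> between u v" "a \<in> between u' v' \<times> between u' v'"
      using same[OF refl, of u v] same[OF refl, of u' v'] arcs uv by (auto simp: between_def)
    then have "a = b" using uv le_antisym by (auto simp: between_def)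
    then show False using a(2) jm b(1) by blast
  qed
qed

lemma card_irreducibles: "card (meet_irreducibles L) = card (join_irreducibles L)"
proof -
  have cov: "covers L (A - R) (A - S)" if RS: "covers L S R" for R S
  proof -
    obtain a where a: "a \<notin> R" "S = insert a R" "biclosed R" "biclosed S" using covers_insert[OF RS] by metis
    have AR: "insert a (A - S) = A - R" using a(1,2) biclosedD(1)[OF a(4)] by auto
    have "covers L (insert a (A - S)) (A - S)"
    proof (rule covers_insertI)
      show "biclosed (A - S)" "biclosed (insert a (A - S))"
        unfolding AR using a(3,4) by (simp_all add: biclosed_compl)
      show "a \<notin> A - S" using a(2) by blast
    qed
    then show ?thesis unfolding AR .
  qed
  have dd: "A - (A - R) = R" if "biclosed R" for R using biclosedD(1)[OF that] by (rule double_diff) simp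
  have bcov: "biclosed R \<and> biclosed S" if "covers L S R" for R S
    using that by (simp add: covers_def AR_simps)
  have ji: "A - j \<in> meet_irreducibles L" if "j \<in> join_irreducibles L" for j
  proof -
    have jb: "biclosed j" and ex: "\<exists>!i. covers L j i"
      using that unfolding join_irreducibles_def AR_simps by blast+
    from ex obtain i where i: "covers L j i" "\<And>i'. covers L j i' \<Longrightarrow> i' = i" by blast
    have "n = A - i" if n: "covers L n (A - j)" for n
      using i(2)[of "A - n"] cov[OF n] dd[of n] dd[OF jb] bcov[OF n] by simp
    then have "\<exists>!n. covers L n (A - j)" using cov[OF i(1)] by blast
    then show ?thesis using biclosed_compl[OF jb] unfolding meet_irreducibles_def AR_simps by blast
  qed
  have mi: "A - m \<in> join_irreducibles L" if "m \<in> meet_irreducibles L" for m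
  proof -
    have mb: "biclosed m" and ex: "\<exists>!n. covers L n m"
      using that unfolding meet_irreducibles_def AR_simps by blast+
    from ex obtain n where n: "covers L n m" "\<And>n'. covers L n' m \<Longrightarrow> n' = n" by blast
    have "i = A - n" if i: "covers L (A - m) i" for i
      using n(2)[of "A - i"] cov[OF i] dd[of i] dd[OF mb] bcov[OF i] by simp
    then have "\<exists>!i. covers L (A - m) i" using cov[OF n(1)] by blast
    then show ?thesis using biclosed_compl[OF mb] unfolding join_irreducibles_def AR_simps by blast
  qed
  have "bij_betw (\<lambda>R. A - R) (meet_irreducibles L) (join_irreducibles L)"
  proof (rule bij_betw_byWitness[where f' = "\<lambda>R. A - R"])
    have "biclosed R" if "R \<in> meet_irreducibles L \<or> R \<in> join_irreducibles L" for R
      using that unfolding meet_irreducibles_def join_irreducibles_def AR_simps by blast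
    then show "\<forall>R \<in> meet_irreducibles L. A - (A - R) = R" "\<forall>R \<in> join_irreducibles L. A - (A - R) = R"
      using dd by blast+
  qed (use ji mi in blast)+
  then show ?thesis by (rule bij_betw_same_card)
qed

end

section \<open>Ropes and congruence uniformity\<close>

context filled_dag
begin

text \<open>The join irreducibles of a filled digraph are the relations rope N x y, where N records the
  vertices w between x and y for which (x,w) is reversed.\<close>

definition rope :: "'a set \<Rightarrow> 'a \<Rightarrow> 'a \<Rightarrow> 'a rel" where
  "rope N x y = {(p, q) \<in> A. (x, p) \<in> A\<^sup>* \<and> (q, y) \<in> A\<^sup>* \<and> (p = x \<or> p \<notin> N) \<and> (q = y \<or> q \<in> N)}"

lemma rope_biclosed: "biclosed (rope N x y)"
proof -
  \<comment> \<open>A rope is the cut whose source side consists of \<open>x\<close> and the inner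
    vertices outside \<open>N\<close>.\<close>
  have "(p, q) \<in> rope N x y \<longleftrightarrow> (p, q) \<in> cut x y ({x} \<union> - N - {y})" for p q
  proof -
    have "p \<noteq> y" "q \<noteq> x" "(p, y) \<in> A\<^sup>*" "(x, q) \<in> A\<^sup>*"
      if "(p, q) \<in> A" "(x, p) \<in> A\<^sup>*" "(q, y) \<in> A\<^sup>*"
      using that less_not_le[of p q]
      by (auto intro: rtrancl_into_rtrancl converse_rtrancl_into_rtrancl)
    then show ?thesis by (auto simp: rope_def cut_def between_def)
  qed
  then have "rope N x y = cut x y ({x} \<union> - N - {y})" by auto
  then show ?thesis by (simp add: cut_biclosed)
qed

lemma interval_arc:
  assumes "(u, v) \<in> A" "(u, x) \<in> A\<^sup>*" "(x, y) \<in> A\<^sup>+" "(y, v) \<in> A\<^sup>*"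
  shows "(x, y) \<in> A"
proof -
  have "(u, y) \<in> A\<^sup>+" using assms(2,3) by (rule rtrancl_trancl_trancl)
  then have uy: "(u, y) \<in> A" using assms(1,4) filled_arcs(1)[of u v y] by (auto simp: le_iff)
  then show ?thesis using assms(2,3) filled_arcs(2)[of u y x] by (auto simp: le_iff)
qed

text \<open>With \<open>N\<close> fixed, a subrope is recorded by its endpoints alone. In this
  encoding meets become intersections and joins become transitive closures of unions.\<close>

definition subropes :: "'a set \<Rightarrow> 'a \<Rightarrow> 'a \<Rightarrow> 'a rel \<Rightarrow> 'a rel" where
  "subropes N u v Q = {(x, y) \<in> A. (u, x) \<in> A\<^sup>* \<and> (y, v) \<in> A\<^sup>* \<and> rope N x y \<subseteq> Q}"

lemma subropes_rel_meet:
  "biclosed R \<Longrightarrow> biclosed S \<Longrightarrow> subropes N u v (rel_meet R S) = subropes N u v R \<inter> subropes N u v S"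
  using rel_meet_lower[of R S] rel_meet_greatest[OF rope_biclosed, of N _ _ R S] by (fastforce simp: subropes_def)

text \<open>An arc of the long rope lies on one side of \<open>z\<close>, hence in one of the short
  ropes, or it passes over \<open>z\<close> and is composed of an arc of each.\<close>

lemma subropes_trans:
  assumes uv: "(u, v) \<in> A" and Q: "biclosed Q"
    and xz: "(x, z) \<in> subropes N u v Q" and zy: "(z, y) \<in> subropes N u v Q"
  shows "(x, y) \<in> subropes N u v Q"
proof -
  have a: "(x, z) \<in> A" "(u, x) \<in> A\<^sup>*" "(z, v) \<in> A\<^sup>*" "rope N x z \<subseteq> Q"
    "(z, y) \<in> A" "(u, z) \<in> A\<^sup>*" "(y, v) \<in> A\<^sup>*" "rope N z y \<subseteq> Q"
    using xz zy by (auto simp: subropes_def)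
  have "(x, y) \<in> A" using interval_arc[OF uv a(2) _ a(7)] a(1,5) by (auto intro: trancl_into_trancl)
  moreover have "(p, q) \<in> Q" if pq: "(p, q) \<in> rope N x y" for p q
  proof -
    have b: "(p, q) \<in> A" "(x, p) \<in> A\<^sup>*" "(q, y) \<in> A\<^sup>*" "p = x \<or> p \<notin> N" "q = y \<or> q \<in> N"
      using pq by (auto simp: rope_def)
    have py: "(p, y) \<in> A\<^sup>*" and xq: "(x, q) \<in> A\<^sup>*"
      using b(1-3) by (auto intro: rtrancl_into_rtrancl converse_rtrancl_into_rtrancl)
    have up: "(u, p) \<in> A\<^sup>*" and qv: "(q, v) \<in> A\<^sup>*" using a b by (auto intro: rtrancl_trans)
    have I: "z \<in> between u v" "p \<in> between u v" "q \<in> between u v"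
      using a up qv py xq by (auto simp: between_def intro: rtrancl_trans)
    consider "(q, z) \<in> A\<^sup>*" | "(z, p) \<in> A\<^sup>*" | "(p, z) \<in> A\<^sup>+" "(z, q) \<in> A\<^sup>+"
      using between_comparable[OF I(1) I(2)] between_comparable[OF I(1) I(3)] by (auto simp: le_iff)
    then show ?thesis
    proof cases
      case 1
      then have "q \<noteq> y" using a(5) less_not_le by blast
      then show ?thesis using 1 b a(4) by (auto simp: rope_def)
    next
      case 2
      then have "p \<noteq> x" using a(1) less_not_le by blast
      then show ?thesis using 2 b a(8) by (auto simp: rope_def)
    next
      case 3
      then have pz: "(p, z) \<in> A" and zq: "(z, q) \<in> A"
        using interval_arc[OF uv up _ a(3)] interval_arc[OF uv a(6) _ qv] by auto
      then have "(p, z) \<in> Q" "(z, q) \<in> Q" using b a(4,8) by (auto simp: rope_def)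
      then show ?thesis using biclosed_closed[OF Q, of p q] b(1) by (meson r_into_trancl trancl_into_trancl)
    qed
  qed
  ultimately show ?thesis using a by (auto simp: subropes_def)
qed

text \<open>If Q is the join of R and S, then a subrope of Q that does not decompose at any inner vertex
  must already lie below R or S.\<close>

lemma subropes_jn_aux:
  assumes uv: "(u, v) \<in> A" and R: "biclosed R" and S: "biclosed S"
    and xy: "(x, y) \<in> subropes N u v (rel_join R S)"
  shows "(x, y) \<in> (subropes N u v R \<union> subropes N u v S)\<^sup>+"
  using xy
proof (induction "card (between x y)" arbitrary: x y rule: less_induct)
  case less
  define Q where "Q = rel_join R S"
  have Q: "biclosed Q" "R \<subseteq> Q" "S \<subseteq> Q" using rel_join_biclosed rel_join_upper R S by (simp_all add: Q_def)
  have xy: "(x, y) \<in> A" "(u, x) \<in> A\<^sup>*" "(y, v) \<in> A\<^sup>*" and rp: "rope N x y \<subseteq> Q"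
    using less(2) by (auto simp: subropes_def Q_def)
  have arc: "(p, q) \<in> A" if "(x, p) \<in> A\<^sup>*" "(p, q) \<in> A\<^sup>+" "(q, y) \<in> A\<^sup>*" for p q
    using interval_arc[OF xy(1) that] .
  have ropeI: "(p, q) \<in> Q" if "(p, q) \<in> A" "(x, p) \<in> A\<^sup>*" "(q, y) \<in> A\<^sup>*"
    "p = x \<or> p \<notin> N" "q = y \<or> q \<in> N" for p q
    using rp that by (auto simp: rope_def)
  \<comment> \<open>The vertices at which \<open>(x, y)\<close> decomposes inside \<open>Q\<close>.
    The induction applies once the rope breaks into two subropes of \<open>Q\<close> at one of
    them.\<close>
  define Zs where "Zs = {z. (x, z) \<in> Q \<and> (z, y) \<in> Q}"
  have ZsA: "(x, z) \<in> A" "(z, y) \<in> A" if "z \<in> Zs" for z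
    using that biclosedD(1)[OF Q(1)] by (auto simp: Zs_def)
  have finZ: "finite Zs"
    by (rule finite_subset[OF _ finite_verts]) (use ZsA arcs_verts in auto)
  have split: ?case
    if z: "z \<in> Zs" and l: "(x, z) \<in> subropes N u v Q" and r: "(z, y) \<in> subropes N u v Q" for z
  proof -
    have "between x z \<subset> between x y" "between z y \<subset> between x y"
      using ZsA[OF z] by (auto intro!: between_psubset1 between_psubset2)
    then have "(x, z) \<in> (subropes N u v R \<union> subropes N u v S)\<^sup>+"
      "(z, y) \<in> (subropes N u v R \<union> subropes N u v S)\<^sup>+"
      using less(1) l r psubset_card_mono[OF finite_between] by (auto simp: Q_def)
    then show ?thesis by (rule trancl_trans)
  qed
  have zv: "(z, v) \<in> A\<^sup>*" "(u, z) \<in> A\<^sup>*" if "z \<in> Zs" for z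
    using ZsA[OF that] xy
    by (auto intro: converse_rtrancl_into_rtrancl rtrancl_into_rtrancl)
  have tri: "(p, q) \<in> Q \<or> (q, r) \<in> Q" if "(p, r) \<in> Q" "(p, q) \<in> A" "(q, r) \<in> A" for p q r
    using biclosed_triangle[OF Q(1) that(2,3,1)] .
  show ?case
  proof (cases "Zs - N = {}")
    case False
    \<comment> \<open>The vertex closest to \<open>x\<close>. Since \<open>z\<close> is not in
      \<open>N\<close>, arcs of the right half are arcs of the whole rope. In the left half only
      arcs \<open>(p, z)\<close> with \<open>p \<noteq> x\<close> are new; if one were missing from
      \<open>Q\<close>, then \<open>p\<close> would be a decomposition vertex outside
      \<open>N\<close> closer to \<open>x\<close>.\<close>
    define z where "z = arg_min_on (\<lambda>z. card (between x z)) (Zs - N)"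
    have z: "z \<in> Zs" "z \<notin> N" and zmin: "\<And>p. p \<in> Zs - N \<Longrightarrow> card (between x z) \<le> card (between x p)"
      using arg_min_if_finite[of "Zs - N" "\<lambda>z. card (between x z)"] finZ False
      by (auto simp: z_def not_less[symmetric])
    have "(p, q) \<in> Q" if pq: "(p, q) \<in> rope N x z" for p q
    proof -
      have b: "(p, q) \<in> A" "(x, p) \<in> A\<^sup>*" "(q, z) \<in> A\<^sup>*" "p = x \<or> p \<notin> N" "q = z \<or> q \<in> N"
        using pq by (auto simp: rope_def)
      have qy: "(q, y) \<in> A\<^sup>*" using b(3) ZsA(2)[OF z(1)] by (rule rtrancl_into_rtrancl)
      show ?thesis
      proof (cases "q \<noteq> z \<or> p = x")
        case True
        then show ?thesis using ropeI[OF b(1,2) qy b(4)] b(5) z by (auto simp: Zs_def)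
      next
        case False
        then have qz: "q = z" and px: "p \<noteq> x" "p \<notin> N" using b by auto
        have xp: "(x, p) \<in> A" using arc[of x p] b px ZsA[OF z(1)] qz
          by (auto simp: le_iff intro: trancl_into_trancl2)
        have py: "(p, y) \<in> A"
          using arc[of p y] b(1,2) ZsA[OF z(1)] qz by (auto intro: trancl_into_trancl)
        show ?thesis
        proof (rule ccontr)
          assume "(p, q) \<notin> Q"
          then have "(x, p) \<in> Q" using tri[of x z p] xp b(1) qz z by (auto simp: Zs_def)
          moreover have "(p, y) \<in> Q" using ropeI[OF py b(2)] px by auto
          ultimately have "p \<in> Zs - N" using px by (simp add: Zs_def)
          moreover have "between x p \<subset> between x z"
            using b(1,2) qz by (intro between_psubset2) auto
          ultimately show False
            using zmin psubset_card_mono[OF finite_between] by (meson not_less)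
        qed
      qed
    qed
    then have l: "(x, z) \<in> subropes N u v Q"
      using ZsA[OF z(1)] zv[OF z(1)] xy by (auto simp: subropes_def)
    have "(p, q) \<in> Q" if pq: "(p, q) \<in> rope N z y" for p q
    proof -
      have b: "(p, q) \<in> A" "(z, p) \<in> A\<^sup>*" "(q, y) \<in> A\<^sup>*" "p = z \<or> p \<notin> N" "q = y \<or> q \<in> N"
        using pq by (auto simp: rope_def)
      have "(x, p) \<in> A\<^sup>*" using ZsA(1)[OF z(1)] b(2) by (rule converse_rtrancl_into_rtrancl)
      then show ?thesis using ropeI[OF b(1)] b z by auto
    qed
    then have "(z, y) \<in> subropes N u v Q"
      using ZsA[OF z(1)] zv[OF z(1)] xy by (auto simp: subropes_def)
    then show ?thesis using split z(1) l by blast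
  next
    case True
    show ?thesis
    proof (cases "Zs = {}")
      case False
      \<comment> \<open>The mirror image: all decomposition vertices are now in \<open>N\<close>, so
        the left half is harmless, and the vertex closest to \<open>y\<close> makes the right half
        work.\<close>
      define z where "z = arg_min_on (\<lambda>z. card (between z y)) Zs"
      have z: "z \<in> Zs" "z \<in> N" and zmin: "\<And>p. p \<in> Zs \<Longrightarrow> card (between z y) \<le> card (between p y)"
        using arg_min_if_finite[of Zs "\<lambda>z. card (between z y)"] finZ False True
        by (auto simp: z_def not_less[symmetric])
      have "(p, q) \<in> Q" if pq: "(p, q) \<in> rope N x z" for p q
      proof -
        have b: "(p, q) \<in> A" "(x, p) \<in> A\<^sup>*" "(q, z) \<in> A\<^sup>*" "p = x \<or> p \<notin> N" "q = z \<or> q \<in> N"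
          using pq by (auto simp: rope_def)
        have "(q, y) \<in> A\<^sup>*" using b(3) ZsA(2)[OF z(1)] by (rule rtrancl_into_rtrancl)
        then show ?thesis using ropeI[OF b(1)] b z by auto
      qed
      then have l: "(x, z) \<in> subropes N u v Q"
        using ZsA[OF z(1)] zv[OF z(1)] xy by (auto simp: subropes_def)
      have "(p, q) \<in> Q" if pq: "(p, q) \<in> rope N z y" for p q
      proof -
        have b: "(p, q) \<in> A" "(z, p) \<in> A\<^sup>*" "(q, y) \<in> A\<^sup>*" "p = z \<or> p \<notin> N" "q = y \<or> q \<in> N"
          using pq by (auto simp: rope_def)
        have xp: "(x, p) \<in> A\<^sup>*" using ZsA(1)[OF z(1)] b(2) by (rule converse_rtrancl_into_rtrancl)
        show ?thesis
        proof (cases "p \<noteq> z \<or> q = y")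
          case True
          then show ?thesis using ropeI[OF b(1) xp b(3) _ b(5)] b(4) z by (auto simp: Zs_def)
        next
          case False
          then have pz: "p = z" and qy: "q \<noteq> y" "q \<in> N" using b by auto
          have "(x, q) \<in> A\<^sup>*" using xp b(1) by (rule rtrancl_into_rtrancl)
          moreover have "(q, y) \<in> A\<^sup>+" using b(3) qy by (simp add: le_iff)
          ultimately have qyA: "(q, y) \<in> A" using arc by blast
          have xq: "(x, q) \<in> A"
            using arc[of x q] b(1,3) ZsA[OF z(1)] pz by (auto intro: trancl_into_trancl)
          show ?thesis
          proof (rule ccontr)
            assume "(p, q) \<notin> Q"
            then have "(q, y) \<in> Q" using tri[of z y q] qyA b(1) pz z by (auto simp: Zs_def)
            moreover have "(x, q) \<in> Q" using ropeI[OF xq _ b(3)] qy by auto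
            ultimately have "q \<in> Zs" by (simp add: Zs_def)
            moreover have "between q y \<subset> between z y"
              using b(1,3) pz by (intro between_psubset1) auto
            ultimately show False
              using zmin psubset_card_mono[OF finite_between] by (meson not_less)
          qed
        qed
      qed
      then have "(z, y) \<in> subropes N u v Q"
        using ZsA[OF z(1)] zv[OF z(1)] xy by (auto simp: subropes_def)
      then show ?thesis using split z(1) l by blast
    next
      case True
      have "(x, y) \<in> Q" using ropeI[OF xy(1)] by simp
      then have RS: "(x, y) \<in> (R \<union> S)\<^sup>+" by (simp add: Q_def rel_join_def)
      \<comment> \<open>The last vertex before \<open>y\<close> on a longer path through
        \<open>R \<union> S\<close> would be a decomposition vertex.\<close>
      have "(x, y) \<in> R \<union> S"
      proof (rule ccontr)
        assume n: "(x, y) \<notin> R \<union> S"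
        obtain z where z: "(x, z) \<in> (R \<union> S)\<^sup>+" "(z, y) \<in> R \<union> S"
          using RS n by (meson tranclE)
        have "(x, z) \<in> A\<^sup>+" "(z, y) \<in> A"
          using z biclosedD(1)[OF R] biclosedD(1)[OF S] trancl_mono[of _ "R \<union> S" A] by auto
        then have "(x, z) \<in> A" using arc[of x z] by auto
        then have "z \<in> Zs" using z Q by (auto simp: Zs_def Q_def rel_join_def)
        then show False using True by simp
      qed
      \<comment> \<open>For an inner source \<open>p\<close> of the rope, \<open>(p, y)\<close> is
        in \<open>Q\<close>, so \<open>(x, p)\<close> is not, and the triangle over
        \<open>(x, y)\<close> puts \<open>(p, y)\<close> in \<open>X\<close>. Dually
        \<open>(x, q)\<close> is in \<open>X\<close> for an inner target \<open>q\<close>. The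
        triangle \<open>x\<close>, \<open>p\<close>, \<open>q\<close> then gives
        \<open>(p, q)\<close>.\<close>
      moreover have "(x, y) \<in> subropes N u v X" if X: "biclosed X" "X \<subseteq> Q" "(x, y) \<in> X" for X
      proof -
        have "(p, q) \<in> X" if pq: "(p, q) \<in> rope N x y" for p q
        proof -
          have b: "(p, q) \<in> A" "(x, p) \<in> A\<^sup>*" "(q, y) \<in> A\<^sup>*" "p = x \<or> p \<notin> N" "q = y \<or> q \<in> N"
            using pq by (auto simp: rope_def)
          have P: "(x, p) \<notin> Q \<and> (p, y) \<in> X \<and> (x, p) \<in> A" if "p \<noteq> x"
          proof -
            have pyA: "(p, y) \<in> A" using arc[of p y] b(1-3) by (auto intro: rtrancl_into_trancl2)
            then have "(p, y) \<in> Q" using ropeI[OF _ b(2)] b(4) that by auto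
            then have n: "(x, p) \<notin> Q" using True by (auto simp: Zs_def)
            moreover have "(x, p) \<in> A" using arc[of x p] b(2) that pyA by (auto simp: le_iff)
            ultimately show ?thesis using biclosed_triangle[OF X(1) _ pyA X(3)] X(2) by blast
          qed
          have Q': "(x, q) \<in> X" if "q \<noteq> y"
          proof -
            have xqA: "(x, q) \<in> A" using arc[of x q] b(1-3) by (auto intro: rtrancl_into_trancl1)
            then have "(x, q) \<in> Q" using ropeI[OF _ _ b(3)] b(5) that by auto
            then have n: "(q, y) \<notin> Q" using True by (auto simp: Zs_def)
            moreover have "(q, y) \<in> A" using arc[of q y] b(3) that xqA by (auto simp: le_iff)
            ultimately show ?thesis using biclosed_triangle[OF X(1) xqA _ X(3)] X(2) by blast
          qed
          show ?thesis
          proof (cases "p = x")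
            case True
            then show ?thesis using Q' X(3) by (cases "q = y") auto
          next
            case False
            note P = P[OF False]
            show ?thesis
            proof (cases "q = y")
              case False
              then show ?thesis using Q' P biclosed_triangle[OF X(1) _ b(1), of x] X(2) by blast
            qed (use P in simp)
          qed
        qed
        then show ?thesis using xy by (auto simp: subropes_def)
      qed
      ultimately have "(x, y) \<in> subropes N u v R \<union> subropes N u v S" using R S Q by blast
      then show ?thesis by blast
    qed
  qed
qed

lemma subropes_rel_join:
  assumes "(u, v) \<in> A" "biclosed R" "biclosed S"
  shows "subropes N u v (rel_join R S) = (subropes N u v R \<union> subropes N u v S)\<^sup>+"
proof
  show "subropes N u v (rel_join R S) \<subseteq> (subropes N u v R \<union> subropes N u v S)\<^sup>+"
    using subropes_jn_aux[OF assms] by auto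
  have sub: "subropes N u v R \<union> subropes N u v S \<subseteq> subropes N u v (rel_join R S)"
    using rel_join_upper[OF assms(2,3)] by (auto simp: subropes_def)
  have "(x, y) \<in> subropes N u v (rel_join R S)" if "(x, y) \<in> (subropes N u v R \<union> subropes N u v S)\<^sup>+" for x y
    using that
  proof (induction rule: trancl_induct)
    case (base y)
    then show ?case using sub by blast
  next
    case (step y z)
    then show ?case using sub subropes_trans[OF assms(1) rel_join_biclosed[OF assms(2,3)]] by blast
  qed
  then show "(subropes N u v R \<union> subropes N u v S)\<^sup>+ \<subseteq> subropes N u v (rel_join R S)" by auto
qed

lemma subropes_congruence:
  assumes "(u, v) \<in> A"
  shows "lattice_congruence L {(R, S). biclosed R \<and> biclosed S \<and> subropes N u v R = subropes N u v S}"
  by (rule kernel_congruence) (simp add: subropes_rel_join[OF assms] subropes_rel_meet)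

section \<open>Join irreducibles as ropes and injectivity\<close>

lemma join_irreducible_eq:
  assumes j: "j \<in> join_irreducibles L" and R: "biclosed R" "R \<subseteq> j" "\<not> R \<subseteq> lower_cover L j"
  shows "R = j"
  using AR.join_irreducibleD(5)[OF j, of R] R by (auto simp: AR.lless_iff)

lemma join_irreducible_rope:
  assumes j: "j \<in> join_irreducibles L"
  obtains N u v where "(u, v) \<in> A" "j = rope N u v" "(u, v) \<notin> lower_cover L j"
proof -
  obtain a where a: "a \<notin> lower_cover L j" "j = insert a (lower_cover L j)"
    "biclosed (lower_cover L j)" "biclosed j"
    using covers_insert[OF AR.join_irreducibleD(1)[OF j]] by metis
  obtain u v where uv: "a = (u, v)" by fastforce
  have uvj: "(u, v) \<in> j" using a(2) uv by blast
  have uvA: "(u, v) \<in> A" using uvj biclosedD(1)[OF a(4)] by blast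
  \<comment> \<open>Read off \<open>N\<close> from the arcs of \<open>j\<close> starting at
    \<open>u\<close>. Triangles based at \<open>u\<close> then force the whole rope into
    \<open>j\<close>, and as it contains \<open>(u, v)\<close> it is not below the lower
    cover.\<close>
  define N where "N = {w. (u, w) \<in> j}"
  have "(p, q) \<in> j" if pq: "(p, q) \<in> rope N u v" for p q
  proof -
    have b: "(p, q) \<in> A" "(u, p) \<in> A\<^sup>*" "(q, v) \<in> A\<^sup>*" "p = u \<or> p \<notin> N" "q = v \<or> q \<in> N"
      using pq by (auto simp: rope_def)
    show ?thesis
    proof (cases "p = u")
      case True
      then show ?thesis using b(5) uvj by (auto simp: N_def)
    next
      case False
      then have n: "(u, p) \<notin> j" using b(4) by (simp add: N_def)
      have pv: "(p, v) \<in> A\<^sup>+" using b(1,3) by (rule rtrancl_into_trancl2)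
      then have upA: "(u, p) \<in> A"
        using interval_arc[OF uvA, of u p] b(2) False by (auto simp: le_iff)
      show ?thesis
      proof (cases "q = v")
        case True
        then show ?thesis using biclosed_triangle[OF a(4) upA b(1)] n uvj by auto
      next
        case False
        then have "(u, q) \<in> j" using b(5) by (simp add: N_def)
        then show ?thesis using biclosed_triangle[OF a(4) upA b(1)] n by blast
      qed
    qed
  qed
  then have "rope N u v \<subseteq> j" by auto
  moreover have "(u, v) \<in> rope N u v" using uvA by (simp add: rope_def)
  ultimately have "rope N u v = j" using join_irreducible_eq[OF j rope_biclosed] a(1) uv by blast
  then show thesis using that[of u v N] a(1) uv uvA by blast
qed

text \<open>The congruence of the subropes of \<open>j\<close> separates \<open>j\<close> from its
  lower cover, so it does the same for \<open>j'\<close>: some subrope lies below \<open>j'\<close>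
  but not below its lower cover, and thus equals \<open>j'\<close>.\<close>

lemma equal_congruence_subrope:
  assumes j: "j \<in> join_irreducibles L" and j': "j' \<in> join_irreducibles L"
    and eq: "principal_congruence L (lower_cover L j) j = principal_congruence L (lower_cover L j') j'"
    and uv: "(u, v) \<in> A" "j = rope N u v" "(u, v) \<notin> lower_cover L j"
  obtains x y where "(u, x) \<in> A\<^sup>*" "(y, v) \<in> A\<^sup>*" "j' = rope N x y"
proof -
  let ?s = "subropes N u v"
  note J = AR.join_irreducibleD[OF j] and J' = AR.join_irreducibleD[OF j']
  have b: "biclosed j" "biclosed (lower_cover L j)" "biclosed j'" "biclosed (lower_cover L j')" "lower_cover L j' \<subseteq> j'"
    using J J' by (auto simp: AR.lless_iff)
  have "?s (lower_cover L j) = ?s j \<longleftrightarrow> ?s (lower_cover L j') = ?s j'"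
    using eq[unfolded AR.principal_congruence_eq_iff[simplified, OF b(2,1,4,3)], rule_format,
        OF subropes_congruence[OF uv(1), of N]] b by simp
  moreover have "(u, v) \<in> ?s j" "(u, v) \<notin> ?s (lower_cover L j)"
    using uv by (auto simp: subropes_def rope_def)
  ultimately have "?s (lower_cover L j') \<noteq> ?s j'" by blast
  moreover have "?s (lower_cover L j') \<subseteq> ?s j'" using b(5) by (auto simp: subropes_def)
  ultimately obtain x y where xy: "(x, y) \<in> ?s j'" "(x, y) \<notin> ?s (lower_cover L j')" by auto
  then have "rope N x y \<subseteq> j'" "\<not> rope N x y \<subseteq> lower_cover L j'" by (auto simp: subropes_def)
  then have "rope N x y = j'" using join_irreducible_eq[OF j' rope_biclosed] by blast
  then show thesis using that xy by (auto simp: subropes_def)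
qed

text \<open>By symmetry each join irreducible is a subrope of the other. Hence the endpoints agree,
  and since \<open>j'\<close> is expressed with the set \<open>N\<close> of \<open>j\<close>, so do
  the ropes.\<close>

lemma congruence_uniform: "congruence_uniform_lattice L"
proof (rule AR.congruence_uniformI[OF _ card_irreducibles], rule inj_onI)
  fix j j' assume j: "j \<in> join_irreducibles L" and j': "j' \<in> join_irreducibles L"
    and eq: "principal_congruence L (lower_cover L j) j = principal_congruence L (lower_cover L j') j'"
  obtain N u v where r: "(u, v) \<in> A" "j = rope N u v" "(u, v) \<notin> lower_cover L j"
    using join_irreducible_rope[OF j] by metis
  obtain N' u' v' where r': "(u', v') \<in> A" "j' = rope N' u' v'" "(u', v') \<notin> lower_cover L j'"
    using join_irreducible_rope[OF j'] by metis
  obtain x y where xy: "(u, x) \<in> A\<^sup>*" "(y, v) \<in> A\<^sup>*" "j' = rope N x y"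
    using equal_congruence_subrope[OF j j' eq r] by metis
  obtain x' y' where xy': "(u', x') \<in> A\<^sup>*" "(y', v') \<in> A\<^sup>*" "j = rope N' x' y'"
    using equal_congruence_subrope[OF j' j eq[symmetric] r'] by metis
  have "(u', v') \<in> rope N x y" using r' xy(3) by (auto simp: rope_def)
  then have m: "(x, u') \<in> A\<^sup>*" "(v', y) \<in> A\<^sup>*" by (auto simp: rope_def)
  have "(u, v) \<in> rope N' x' y'" using r xy'(3) by (auto simp: rope_def)
  then have m': "(x', u) \<in> A\<^sup>*" "(v, y') \<in> A\<^sup>*" by (auto simp: rope_def)
  have "(x, u) \<in> A\<^sup>*" using m(1) xy'(1) m'(1) by (meson rtrancl_trans)
  then have "x = u" using xy(1) le_antisym by blast
  moreover have "(v, y) \<in> A\<^sup>*" using m(2) xy'(2) m'(2) by (meson rtrancl_trans)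
  then have "y = v" using xy(2) le_antisym by blast
  ultimately show "j = j'" using r(2) xy(3) by simp
qed

end

theorem theorem3:
  fixes D :: "'a pair_pre_digraph"
  assumes "pair_digraph D" and "acyclic (parcs D)" and "vertebrate D"
  shows "(distributive_lattice (acyclic_reorientations D) \<longleftrightarrow> forest_digraph D) \<and>
         (semidistributive_lattice (acyclic_reorientations D) \<longleftrightarrow> filled D) \<and>
         congruence_normal_lattice (acyclic_reorientations D) \<and>
         (congruence_uniform_lattice (acyclic_reorientations D) \<longleftrightarrow> filled D)"
proof -
  interpret vertebrate_dag D by (rule vertebrate_dag.intro) (fact assms)+
  have "congruence_uniform_lattice L \<longleftrightarrow> filled D"
  proof
    assume c: "congruence_uniform_lattice L"
    show "filled D"
    proof (rule ccontr)
      assume "\<not> filled D"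
      then obtain u v w where "unfilled D u v w" by (rule not_filled_unfilled)
      then interpret unfilled D u v w .
      show False using not_congruence_uniform c by simp
    qed
  next
    assume "filled D"
    then interpret filled_dag D by unfold_locales
    show "congruence_uniform_lattice L" by (rule congruence_uniform)
  qed
  then show ?thesis
    using distributive_iff semidistributive_iff congruence_normal by blast
qed

end
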